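(* Suppose that the Banach space $E$ has the approximation property. Then $\Upsilon_{p^{*}}(E,X)=\mathcal U_{*}^{p}(E,X)$ for all Banach lattices $X$.
   Context: All Banach spaces and Banach lattices are real; operators are bounded and linear, and $\mathcal L(E,F)$ is the space of all operators from $E$ to $F$. $p\in[1,\infty]$ and $p^{*}$ is the conjugate exponent, $\frac1p+\frac1{p^*}=1$. For a Banach lattice $X$, $X_+$ is the positive cone. For a Banach space $E$, $B_E$ is its closed unit ball, $l_p(E)$ is the space of $p$-summable sequences with norm $\|(u_n)_n\|_p=(\sum_n\|u_n\|^p)^{1/p}$, and $l_p^w(E)$ is the space of weakly $p$-summable sequences with norm $\|(u_n)_n\|_p^w=\sup_{u^*\in B_{E^*}}(\sum_n|\langle u^*,u_n\rangle|^p)^{1/p}$ (usual modification for exponent $\infty$; same notation for finite sequences). $l_p^w(X)_+$ denotes the sequences in $l_p^w(X)$ with all terms in $X_+$. $x^*\otimes u$ is the operator $x\mapsto\langle x^*,x\rangle u$. Positively $p$-nuclear operators: $T:X\to E$ is positively $p$-nuclear if $T=\sum_{j=1}^\infty x_j^*\otimes u_j$ with $(x_j^* )_j\in l^w_{p^*}(X^* )_+$ and $(u_j)_j\in l_p(E)$; $\widetilde\nu^p(T)=\inf\|(x_j^* )_j\|^w_{p^*}\|(u_j)_j\|_p$ over all such representations; $\widetilde{\mathcal N}^p(X,E)$ is the space of these operators. Positive $p$-majorizing operators: $S:E\to X$ is positive $p$-majorizing if there is $C>0$ with $(\sum_{j=1}^n|\langle x_j^*,Su_j\rangle|^p)^{1/p}\le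 C\|(x_j^* )_{j=1}^n\|_p^w$ for all finite families $(u_j)_{j=1}^n$ in $B_E$ and $(x_j^* )_{j=1}^n$ in $(X^* )_+$. $\Upsilon_p(E,X)$ is the space of these operators, a Banach space under the norm $\|S\|_{\Upsilon_p}$ given by the infimum of such $C$; $\Upsilon_{p^*}(E,X)$ is the same with $p^*$ in place of $p$. $\mathcal N(E)$ is the space of nuclear operators on $E$, i.e. $U=\sum_n u_n^*\otimes u_n$ with $\sum_n\|u_n^*\|\|u_n\|<\infty$, with nuclear norm $\nu(U)=\inf\sum_n\|u_n^*\|\|u_n\|$ over such representations. $\mathcal U_*^p(E,X):=\{S\in\mathcal L(E,X): TS\text{ is nuclear for all }T\in\widetilde{\mathcal N}^p(X,E)\}$. For $S\in\mathcal U_*^p(E,X)$, the map $V_S:\widetilde{\mathcal N}^p(X,E)\to\mathcal N(E)$, $T\mapsto TS$, is continuous (by the closed graph theorem), and $\mathcal U_*^p(E,X)$ is a Banach space under the norm $\zeta^p(S):=\|V_S\|$, the operator norm with respect to $\widetilde\nu^p$ and $\nu$. $E$ has the approximation property if for every $\epsilon>0$ and every compact $K\subset E$ there is a finite rank operator $S$ on $E$ with $\|Su-u\|<\epsilon$ for all $u\in K$. *)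

theory Defs
  imports "HOL-Analysis.Analysis" "HOL-Library.Lattice_Algebras"
begin

class banach_lattice = banach + ordered_real_vector + lattice_ab_group_add_abs +
  assumes abs_le_imp_norm_le: "\<bar>x\<bar> \<le> \<bar>y\<bar> \<Longrightarrow> norm x \<le> norm y"

instance real :: banach_lattice
  by standard simp

definition dual_cone :: "('x::banach_lattice \<Rightarrow>\<^sub>L real) set" where
  "dual_cone = {\<phi>. \<forall>x\<ge>0. 0 \<le> blinfun_apply \<phi> x}"

text \<open>This relies on \<open>inverse 0 = \<infinity>\<close> and \<open>inverse \<infinity> = 0\<close> at the endpoints \<open>p = 1\<close> and \<open>p = \<infinity>\<close>.\<close>

definition conj_exp :: "ennreal \<Rightarrow> ennreal" where
  "conj_exp p = inverse (1 - inverse p)"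

lemma conj_exp:
  assumes "1 \<le> p"
  shows "inverse p + inverse (conj_exp p) = 1"
proof (cases p)
  case (real r)
  with assms have r: "1 \<le> r"
    by simp
  show ?thesis
  proof (cases "r = 1")
    case True
    with real show ?thesis
      by (simp add: conj_exp_def)
  next
    case False
    with r have "r > 1"
      by simp
    then have "1 - 1 / r > 0"
      by simp
    moreover have "1 - inverse p = ennreal (1 - 1 / r)"
      using real \<open>r > 1\<close> by (simp add: inverse_ennreal ennreal_minus inverse_eq_divide flip: ennreal_1)
    ultimately show ?thesis
      using real \<open>r > 1\<close>
      by (simp add: conj_exp_def inverse_ennreal inverse_eq_divide flip: ennreal_plus)
  qed
next
  case top
  then show ?thesis
    by (simp add: conj_exp_def)
qed

definition p_summable :: "ennreal \<Rightarrow> (nat \<Rightarrow> real) \<Rightarrow> bool" where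
  "p_summable p a \<longleftrightarrow>
     (if p = \<infinity> then bdd_above (range (\<lambda>n. \<bar>a n\<bar>))
      else summable (\<lambda>n. \<bar>a n\<bar> powr enn2real p))"

definition p_norm :: "ennreal \<Rightarrow> (nat \<Rightarrow> real) \<Rightarrow> real" where
  "p_norm p a =
     (if p = \<infinity> then (SUP n. \<bar>a n\<bar>)
      else (\<Sum>n. \<bar>a n\<bar> powr enn2real p) powr (1 / enn2real p))"

definition lp :: "ennreal \<Rightarrow> (nat \<Rightarrow> 'a::real_normed_vector) set" where
  "lp p = {u. p_summable p (\<lambda>n. norm (u n))}"

definition lp_norm :: "ennreal \<Rightarrow> (nat \<Rightarrow> 'a::real_normed_vector) \<Rightarrow> real" where
  "lp_norm p u = p_norm p (\<lambda>n. norm (u n))"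

definition lpw :: "ennreal \<Rightarrow> (nat \<Rightarrow> 'a::real_normed_vector) set" where
  "lpw p = {u. \<forall>\<phi>::'a \<Rightarrow>\<^sub>L real. p_summable p (\<lambda>n. blinfun_apply \<phi> (u n))}"

definition lpw_norm :: "ennreal \<Rightarrow> (nat \<Rightarrow> 'a::real_normed_vector) \<Rightarrow> real" where
  "lpw_norm p u =
     (SUP \<phi>\<in>{\<phi>::'a \<Rightarrow>\<^sub>L real. norm \<phi> \<le> 1}. p_norm p (\<lambda>n. blinfun_apply \<phi> (u n)))"

text \<open>A finite family \<open>u\<^sub>0, \<dots>, u\<^sub>n\<^sub>-\<^sub>1\<close> is identified with its extension by zero, which has the
  same (strong or weak) p-norm.\<close>

definition fin_seq :: "nat \<Rightarrow> (nat \<Rightarrow> 'a::zero) \<Rightarrow> nat \<Rightarrow> 'a" where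
  "fin_seq n u = (\<lambda>j. if j < n then u j else 0)"

definition rank_one ::
  "('a::real_normed_vector \<Rightarrow>\<^sub>L real) \<Rightarrow> 'b::real_normed_vector \<Rightarrow> 'a \<Rightarrow>\<^sub>L 'b" where
  "rank_one \<phi> u = blinfun_scaleR_left u o\<^sub>L \<phi>"

text \<open>The series \<open>\<Sum>\<^sub>j \<phi>\<^sub>j \<otimes> u\<^sub>j\<close> is taken pointwise. For nuclear operators, and for positively
  p-nuclear operators with \<open>p < \<infinity>\<close>, the summability conditions on \<open>\<phi>\<close> and \<open>u\<close> force convergence in
  the operator norm as well; for \<open>p = \<infinity>\<close> they only guarantee pointwise convergence.\<close>

definition rank_one_series ::
  "(nat \<Rightarrow> 'a::real_normed_vector \<Rightarrow>\<^sub>L real) \<Rightarrow> (nat \<Rightarrow> 'b::real_normed_vector) \<Rightarrow> ('a \<Rightarrow>\<^sub>L 'b) \<Rightarrow> bool"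
  where "rank_one_series \<phi> u T \<longleftrightarrow>
     (\<forall>x. (\<lambda>j. blinfun_apply (rank_one (\<phi> j) (u j)) x) sums blinfun_apply T x)"

definition nuclear_rep ::
  "('a::real_normed_vector \<Rightarrow>\<^sub>L 'b::real_normed_vector) \<Rightarrow> (nat \<Rightarrow> 'a \<Rightarrow>\<^sub>L real) \<Rightarrow> (nat \<Rightarrow> 'b) \<Rightarrow> bool"
  where "nuclear_rep U \<phi> u \<longleftrightarrow>
     summable (\<lambda>n. norm (\<phi> n) * norm (u n)) \<and> rank_one_series \<phi> u U"

definition nuclear :: "('a::real_normed_vector \<Rightarrow>\<^sub>L 'b::real_normed_vector) set" where
  "nuclear = {U. \<exists>\<phi> u. nuclear_rep U \<phi> u}"

definition nuclear_norm :: "('a::real_normed_vector \<Rightarrow>\<^sub>L 'b::real_normed_vector) \<Rightarrow> real" where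
  "nuclear_norm U = Inf {\<Sum>n. norm (\<phi> n) * norm (u n) | \<phi> u. nuclear_rep U \<phi> u}"

definition pos_nuclear_rep ::
  "ennreal \<Rightarrow> ('x::banach_lattice \<Rightarrow>\<^sub>L 'e::banach) \<Rightarrow> (nat \<Rightarrow> 'x \<Rightarrow>\<^sub>L real) \<Rightarrow> (nat \<Rightarrow> 'e) \<Rightarrow> bool"
  where "pos_nuclear_rep p T \<phi> u \<longleftrightarrow>
     \<phi> \<in> lpw (conj_exp p) \<and> (\<forall>j. \<phi> j \<in> dual_cone) \<and> u \<in> lp p \<and> rank_one_series \<phi> u T"

definition pos_nuclear :: "ennreal \<Rightarrow> ('x::banach_lattice \<Rightarrow>\<^sub>L 'e::banach) set" where
  "pos_nuclear p = {T. \<exists>\<phi> u. pos_nuclear_rep p T \<phi> u}"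

definition pos_nuclear_norm :: "ennreal \<Rightarrow> ('x::banach_lattice \<Rightarrow>\<^sub>L 'e::banach) \<Rightarrow> real" where
  "pos_nuclear_norm p T =
     Inf {lpw_norm (conj_exp p) \<phi> * lp_norm p u | \<phi> u. pos_nuclear_rep p T \<phi> u}"

definition majorizing_const :: "ennreal \<Rightarrow> ('e::banach \<Rightarrow>\<^sub>L 'x::banach_lattice) \<Rightarrow> real \<Rightarrow> bool" where
  "majorizing_const p S C \<longleftrightarrow>
     (\<forall>n u \<phi>. (\<forall>j<n. norm (u j) \<le> 1) \<longrightarrow> (\<forall>j<n. \<phi> j \<in> dual_cone) \<longrightarrow>
        p_norm p (fin_seq n (\<lambda>j. blinfun_apply (\<phi> j) (blinfun_apply S (u j))))
          \<le> C * lpw_norm p (fin_seq n \<phi>))"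

definition pos_majorizing :: "ennreal \<Rightarrow> ('e::banach \<Rightarrow>\<^sub>L 'x::banach_lattice) set" where
  "pos_majorizing p = {S. \<exists>C>0. majorizing_const p S C}"

definition pos_majorizing_norm :: "ennreal \<Rightarrow> ('e::banach \<Rightarrow>\<^sub>L 'x::banach_lattice) \<Rightarrow> real" where
  "pos_majorizing_norm p S = Inf {C. C > 0 \<and> majorizing_const p S C}"

definition U_star :: "ennreal \<Rightarrow> ('e::banach \<Rightarrow>\<^sub>L 'x::banach_lattice) set" where
  "U_star p = {S. \<forall>T\<in>(pos_nuclear p :: ('x \<Rightarrow>\<^sub>L 'e) set). T o\<^sub>L S \<in> nuclear}"

text \<open>The operator norm of \<open>T \<mapsto> T S\<close> with respect to the positively p-nuclear and nuclear norms.
  The supremum is over a bounded set whenever \<open>S \<in> U_star p\<close>, by the closed graph theorem.\<close>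

definition zeta :: "ennreal \<Rightarrow> ('e::banach \<Rightarrow>\<^sub>L 'x::banach_lattice) \<Rightarrow> real" where
  "zeta p S =
     (SUP T\<in>{T::'x \<Rightarrow>\<^sub>L 'e. T \<in> pos_nuclear p \<and> pos_nuclear_norm p T \<le> 1}. nuclear_norm (T o\<^sub>L S))"

definition finite_rank :: "('a::real_normed_vector \<Rightarrow>\<^sub>L 'b::real_normed_vector) \<Rightarrow> bool" where
  "finite_rank S \<longleftrightarrow> (\<exists>B. finite B \<and> range (blinfun_apply S) \<subseteq> span B)"

definition approximation_property :: "'e::banach itself \<Rightarrow> bool" where
  "approximation_property _ \<longleftrightarrow>
     (\<forall>\<epsilon>>0. \<forall>K::'e set. compact K \<longrightarrow>
        (\<exists>S::'e \<Rightarrow>\<^sub>L 'e. finite_rank S \<and> (\<forall>u\<in>K. norm (blinfun_apply S u - u) < \<epsilon>)))"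

end

theory Submission
  imports Defs
begin

text \<open>If \<open>S\<close> is positive \<open>p\<^sup>*\<close>-majorizing with constant \<open>C\<close> and \<open>T = \<Sum>\<^sub>j \<phi>\<^sub>j \<otimes> u\<^sub>j\<close>, then
  \<open>TS = \<Sum>\<^sub>j S\<^sup>*\<phi>\<^sub>j \<otimes> u\<^sub>j\<close>; almost maximizing each \<open>S\<^sup>*\<phi>\<^sub>j\<close> on the unit ball bounds
  the strong \<open>p\<^sup>*\<close>-norm of \<open>(S\<^sup>*\<phi>\<^sub>j)\<close> by \<open>C\<close> times the weak norm of \<open>(\<phi>\<^sub>j)\<close>, and Hoelder's
  inequality bounds the nuclear norm of \<open>TS\<close>. Conversely, for finitely many \<open>\<phi>\<^sub>j \<ge> 0\<close> and \<open>v\<^sub>j\<close> in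
  the unit ball choose \<open>a\<close> in the unit ball of \<open>l\<^sub>p\<close> norming \<open>(\<phi>\<^sub>j(S v\<^sub>j))\<close>. Its \<open>p\<^sup>*\<close>-norm is the
  trace of \<open>TS\<close> with \<open>T = \<Sum>\<^sub>j a\<^sub>j \<phi>\<^sub>j \<otimes> v\<^sub>j\<close>, and by the approximation property the trace of a finite
  rank operator is at most its nuclear norm. That \<open>T \<mapsto> TS\<close> is bounded at all comes from
  Zabreiko's lemma (a countably subadditive seminorm on a Banach space is bounded), applied to
  multipliers of a single representation that gathers a sequence of increasingly bad finite ones.\<close>

subsection \<open>Sequence norms\<close>

lemma exponent_cases [consumes 1]:
  assumes "1 \<le> (s::ennreal)"
  obtains (top) "s = \<infinity>" | (real) P where "1 \<le> P" "s = ennreal P" "enn2real s = P" "s \<noteq> \<infinity>"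
proof (cases s)
  case (real r)
  with assms have "1 \<le> r" by simp
  with real that show ?thesis by simp
qed (use that in simp)

text \<open>At each endpoint one of the two conjugate norms is a supremum, so the endpoints are
  split off. In the interior case the \<open>ennreal\<close> arithmetic is done here once, and later
  arguments work with the real exponents \<open>P\<close> and \<open>R\<close>.\<close>

lemma conj_exp_cases [consumes 1]:
  assumes "1 \<le> (p::ennreal)"
  obtains (one) "p = 1" "conj_exp p = \<infinity>"
  | (top) "p = \<infinity>" "conj_exp p = 1"
  | (real) P R where "p = ennreal P" "conj_exp p = ennreal R" "1 < P" "1 < R" "1 / P + 1 / R = 1"
using assms proof (cases rule: exponent_cases)
  case top
  then show ?thesis using that(2) by (simp add: conj_exp_def)
next
  case (real P)
  show ?thesis
  proof (cases "P = 1")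
    case True
    then show ?thesis using real that(1) by (simp add: conj_exp_def)
  next
    case False
    with real have P: "P > 1" by simp
    define R where "R = 1 / (1 - 1 / P)"
    have pos: "1 - 1 / P > 0" using P by simp
    have "1 - inverse p = ennreal (1 - 1 / P)"
      using real P by (simp add: inverse_ennreal ennreal_minus inverse_eq_divide flip: ennreal_1)
    then have "conj_exp p = ennreal R"
      using pos by (simp add: conj_exp_def R_def inverse_ennreal inverse_eq_divide)
    moreover have "1 < R" "1 / P + 1 / R = 1"
      using P pos by (simp_all add: R_def field_simps)
    ultimately show ?thesis using real P that(3) by blast
  qed
qed

lemma conj_exp_ge_1:
  assumes "1 \<le> p"
  shows "1 \<le> conj_exp p"
  using assms by (cases rule: conj_exp_cases) auto

lemma p_summable_mono:
  assumes "p_summable s b" "\<And>n. \<bar>a n\<bar> \<le> \<bar>b n\<bar>"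
  shows "p_summable s a"
proof (cases "s = \<infinity>")
  case True
  with assms show ?thesis
    by (auto simp: p_summable_def bdd_above_def intro: order_trans)
next
  case False
  with assms(1) have "summable (\<lambda>n. \<bar>b n\<bar> powr enn2real s)" by (simp add: p_summable_def)
  then have "summable (\<lambda>n. \<bar>a n\<bar> powr enn2real s)"
    by (rule summable_comparison_test[rotated]) (use assms(2) in \<open>auto intro!: powr_mono2 exI[of _ 0]\<close>)
  with False show ?thesis by (simp add: p_summable_def)
qed

lemma p_norm_mono:
  assumes "p_summable s b" "\<And>n. \<bar>a n\<bar> \<le> \<bar>b n\<bar>"
  shows "p_norm s a \<le> p_norm s b"
proof (cases "s = \<infinity>")
  case True
  with assms show ?thesis
    by (auto simp: p_summable_def p_norm_def intro!: cSUP_mono)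
next
  case False
  with assms p_summable_mono[OF assms]
  have "summable (\<lambda>n. \<bar>b n\<bar> powr enn2real s)" "summable (\<lambda>n. \<bar>a n\<bar> powr enn2real s)"
    by (simp_all add: p_summable_def)
  then have "(\<Sum>n. \<bar>a n\<bar> powr enn2real s) \<le> (\<Sum>n. \<bar>b n\<bar> powr enn2real s)"
    using assms(2) by (intro suminf_le) (auto intro!: powr_mono2)
  moreover have "0 \<le> (\<Sum>n. \<bar>a n\<bar> powr enn2real s)"
    using \<open>summable (\<lambda>n. \<bar>a n\<bar> powr enn2real s)\<close> by (intro suminf_nonneg) auto
  ultimately show ?thesis using False
    by (simp add: p_norm_def powr_mono2)
qed

lemma p_norm_nonneg:
  assumes "p_summable s a"
  shows "0 \<le> p_norm s a"
proof (cases "s = \<infinity>")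
  case True
  then show ?thesis using assms
    by (auto simp: p_norm_def p_summable_def intro: cSUP_upper2[of _ _ 0])
qed (simp add: p_norm_def)

lemma p_norm_zero [simp]: "p_norm s (\<lambda>_. 0) = 0"
  by (simp add: p_norm_def)

lemma p_summable_zero [simp]: "p_summable s (\<lambda>_. 0)"
  by (simp add: p_summable_def)

lemma p_summable_scale:
  assumes "p_summable s a"
  shows "p_summable s (\<lambda>n. c * a n)"
proof (cases "s = \<infinity>")
  case True
  with assms obtain M where "\<And>n. \<bar>a n\<bar> \<le> M" by (auto simp: p_summable_def bdd_above_def)
  then have "\<bar>c * a n\<bar> \<le> \<bar>c\<bar> * M" for n by (simp add: abs_mult mult_left_mono)
  with True show ?thesis by (auto simp: p_summable_def bdd_above_def)
next
  case False
  with assms show ?thesis by (auto simp: p_summable_def abs_mult powr_mult intro!: summable_mult)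
qed

lemma p_norm_scale:
  assumes "1 \<le> s" "p_summable s a"
  shows "p_norm s (\<lambda>n. c * a n) = \<bar>c\<bar> * p_norm s a"
using assms(1) proof (cases rule: exponent_cases)
  case top
  with assms have bdd: "bdd_above (range (\<lambda>n. \<bar>a n\<bar>))" by (simp add: p_summable_def)
  show ?thesis
  proof (cases "c = 0")
    case False
    have "(SUP n. \<bar>c\<bar> * \<bar>a n\<bar>) = \<bar>c\<bar> * (SUP n. \<bar>a n\<bar>)"
    proof (rule antisym)
      show "(SUP n. \<bar>c\<bar> * \<bar>a n\<bar>) \<le> \<bar>c\<bar> * (SUP n. \<bar>a n\<bar>)"
        using bdd by (intro cSUP_least mult_left_mono cSUP_upper) auto
      have "p_summable s (\<lambda>n. c * a n)" using assms(2) by (rule p_summable_scale)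
      then have bdd': "bdd_above (range (\<lambda>n. \<bar>c\<bar> * \<bar>a n\<bar>))" using top by (simp add: p_summable_def abs_mult)
      have "(SUP n. \<bar>a n\<bar>) \<le> (SUP n. \<bar>c\<bar> * \<bar>a n\<bar>) / \<bar>c\<bar>"
      proof (rule cSUP_least)
        fix n
        have "\<bar>c\<bar> * \<bar>a n\<bar> \<le> (SUP n. \<bar>c\<bar> * \<bar>a n\<bar>)" by (rule cSUP_upper[OF _ bdd']) auto
        then show "\<bar>a n\<bar> \<le> (SUP n. \<bar>c\<bar> * \<bar>a n\<bar>) / \<bar>c\<bar>" using False by (simp add: field_simps)
      qed auto
      then show "\<bar>c\<bar> * (SUP n. \<bar>a n\<bar>) \<le> (SUP n. \<bar>c\<bar> * \<bar>a n\<bar>)" using False by (simp add: field_simps)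
    qed
    then show ?thesis using top by (simp add: p_norm_def abs_mult)
  qed simp
next
  case (real P)
  with assms have "summable (\<lambda>n. \<bar>a n\<bar> powr P)" by (simp add: p_summable_def)
  then have "(\<Sum>n. \<bar>c * a n\<bar> powr P) = \<bar>c\<bar> powr P * (\<Sum>n. \<bar>a n\<bar> powr P)"
    by (simp add: abs_mult powr_mult suminf_mult)
  then show ?thesis using real \<open>summable _\<close>
    by (simp add: p_norm_def powr_mult powr_powr suminf_nonneg)
qed

lemma p_summable_finite_support:
  assumes "\<And>j. N \<le> j \<Longrightarrow> a j = 0"
  shows "p_summable s a"
proof (cases "s = \<infinity>")
  case True
  have "range (\<lambda>n. \<bar>a n\<bar>) \<subseteq> insert 0 ((\<lambda>n. \<bar>a n\<bar>) ` {..<N})"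
    using assms by (auto simp: image_iff) (metis lessThan_iff not_less abs_zero)
  then have "finite (range (\<lambda>n. \<bar>a n\<bar>))" by (rule finite_subset) auto
  with True show ?thesis by (simp add: p_summable_def)
next
  case False
  have "summable (\<lambda>n. \<bar>a n\<bar> powr enn2real s)"
    by (rule summable_finite[of "{..<N}"]) (use assms in \<open>auto simp: not_less\<close>)
  with False show ?thesis by (simp add: p_summable_def)
qed

lemma p_summable_fin_seq [simp]: "p_summable s (fin_seq N a)"
  by (rule p_summable_finite_support[of N]) (simp add: fin_seq_def)

lemma p_norm_top_fin_seq: "(\<And>j. j < N \<Longrightarrow> \<bar>a j\<bar> \<le> D) \<Longrightarrow> 0 \<le> D \<Longrightarrow> p_norm \<infinity> (fin_seq N a) \<le> D"
  by (auto simp: p_norm_def fin_seq_def intro!: cSUP_least)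

lemma p_norm_fin_seq:
  assumes "1 \<le> P"
  shows "p_norm (ennreal P) (fin_seq N a) = (\<Sum>j<N. \<bar>a j\<bar> powr P) powr (1 / P)"
proof -
  have "(\<Sum>n. \<bar>fin_seq N a n\<bar> powr P) = (\<Sum>n<N. \<bar>fin_seq N a n\<bar> powr P)"
    by (rule suminf_finite) (auto simp: fin_seq_def)
  also have "\<dots> = (\<Sum>j<N. \<bar>a j\<bar> powr P)" by (simp add: fin_seq_def)
  finally show ?thesis using assms by (simp add: p_norm_def)
qed

lemma p_norm_fin_seq_1: "p_norm 1 (fin_seq N a) = (\<Sum>j<N. \<bar>a j\<bar>)"
  using p_norm_fin_seq[of 1 N a] by (simp add: sum_nonneg)

lemma abs_le_p_norm_top: "p_summable \<infinity> a \<Longrightarrow> \<bar>a n\<bar> \<le> p_norm \<infinity> a"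
  by (auto simp: p_norm_def p_summable_def intro!: cSUP_upper)

lemma abs_le_p_norm_top_fin_seq:
  assumes "j < N"
  shows "\<bar>a j\<bar> \<le> p_norm \<infinity> (fin_seq N a)"
proof -
  have "\<bar>fin_seq N a j\<bar> \<le> p_norm \<infinity> (fin_seq N a)" by (rule abs_le_p_norm_top) simp
  moreover have "fin_seq N a j = a j" using assms by (simp add: fin_seq_def)
  ultimately show ?thesis by simp
qed

text \<open>Bounded partial sums of nonnegative terms converge, so estimates for finite families
  carry over to infinite sequences. This is how the majorizing inequality, which speaks of finite
  families only, reaches sequences in \<open>lpw\<close>.\<close>

lemma p_norm_limit:
  assumes s: "1 \<le> s" and bound: "\<And>N. p_norm s (fin_seq N a) \<le> D"
  shows "p_summable s a" "p_norm s a \<le> D"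
proof -
  have "p_summable s a \<and> p_norm s a \<le> D"
  using s proof (cases rule: exponent_cases)
    case top
    have "\<bar>a n\<bar> \<le> D" for n
      using abs_le_p_norm_top_fin_seq[of n "Suc n" a] bound[of "Suc n"] top by simp
    with top show ?thesis by (auto simp: p_summable_def p_norm_def bdd_above_def intro: cSUP_least)
  next
    case (real P)
    \<comment> \<open>The empty truncation forces \<open>D\<close> to be nonnegative;
      \<open>(D powr P) powr (1 / P)\<close> returns \<open>D\<close> only for such
      \<open>D\<close>.\<close>
    have D: "0 \<le> D" using bound[of 0] p_norm_nonneg[of s "fin_seq 0 a"] by simp
    have le: "(\<Sum>j<N. \<bar>a j\<bar> powr P) \<le> D powr P" for N
    proof -
      have "(\<Sum>j<N. \<bar>a j\<bar> powr P) powr (1 / P) \<le> D"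
        using bound[of N] real by (simp add: p_norm_fin_seq)
      then have "((\<Sum>j<N. \<bar>a j\<bar> powr P) powr (1 / P)) powr P \<le> D powr P"
        using real by (intro powr_mono2) auto
      then show ?thesis using real by (simp add: powr_powr sum_nonneg)
    qed
    have sm: "summable (\<lambda>j. \<bar>a j\<bar> powr P)"
      by (rule bounded_imp_summable[where B = "D powr P"]) (auto simp: le simp flip: lessThan_Suc_atMost simp del: sum.lessThan_Suc)
    then have "(\<Sum>j. \<bar>a j\<bar> powr P) \<le> D powr P"
      by (intro suminf_le_const le)
    then have "(\<Sum>j. \<bar>a j\<bar> powr P) powr (1 / P) \<le> (D powr P) powr (1 / P)"
      using real by (intro powr_mono2 suminf_nonneg sm) auto
    then show ?thesis using real sm D by (simp add: p_norm_def p_summable_def powr_powr)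
  qed
  then show "p_summable s a" "p_norm s a \<le> D" by auto
qed

lemma p_norm_fin_seq_le:
  assumes "p_summable s a"
  shows "p_norm s (fin_seq N a) \<le> p_norm s a"
  using assms by (rule p_norm_mono) (simp add: fin_seq_def)

section \<open>Hoelder's inequality and its extremal sequences\<close>

lemma Hoelder_sum_real:
  fixes a b :: "'i \<Rightarrow> real"
  assumes "1 < P" "1 < R" "1 / P + 1 / R = 1" "finite F"
    and nonneg: "\<And>j. j \<in> F \<Longrightarrow> 0 \<le> a j" "\<And>j. j \<in> F \<Longrightarrow> 0 \<le> b j"
  shows "(\<Sum>j\<in>F. a j * b j) \<le> (\<Sum>j\<in>F. a j powr P) powr (1 / P) * (\<Sum>j\<in>F. b j powr R) powr (1 / R)"
proof -
  define A where "A = (\<Sum>j\<in>F. a j powr P) powr (1 / P)"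
  define B where "B = (\<Sum>j\<in>F. b j powr R) powr (1 / R)"
  have AP: "A powr P = (\<Sum>j\<in>F. a j powr P)" and BR: "B powr R = (\<Sum>j\<in>F. b j powr R)"
    using assms(1,2) sum_nonneg[of F "\<lambda>j. a j powr P"] sum_nonneg[of F "\<lambda>j. b j powr R"]
    by (simp_all add: A_def B_def powr_powr)
  have [simp]: "0 \<le> A" "0 \<le> B" by (auto simp: A_def B_def)
  show ?thesis
  proof (cases "A = 0 \<or> B = 0")
    case True
    have "a j * b j = 0" if "j \<in> F" for j
    proof -
      have "(\<Sum>j\<in>F. a j powr P) = 0 \<or> (\<Sum>j\<in>F. b j powr R) = 0"
        using True AP BR assms by auto
      then show ?thesis using that \<open>finite F\<close> by (auto simp: sum_nonneg_eq_0_iff)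
    qed
    then have "(\<Sum>j\<in>F. a j * b j) = 0" by (intro sum.neutral) blast
    then show ?thesis by simp
  next
    case False
    then have pos: "A > 0" "B > 0" using \<open>0 \<le> A\<close> \<open>0 \<le> B\<close> by linarith+
    \<comment> \<open>Young's inequality for the normalized terms sums to
      \<open>1 / P + 1 / R = 1\<close>. Dividing by \<open>A\<close> and \<open>B\<close> is why a
      vanishing norm was treated apart.\<close>
    have "(\<Sum>j\<in>F. (a j / A) * (b j / B)) \<le> (\<Sum>j\<in>F. (a j / A) powr P / P + (b j / B) powr R / R)"
      using assms pos by (intro sum_mono Youngs_inequality) auto
    also have "\<dots> = (\<Sum>j\<in>F. a j powr P) / A powr P / P + (\<Sum>j\<in>F. b j powr R) / B powr R / R"
      using nonneg pos by (simp add: sum.distrib powr_divide sum_divide_distrib)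
    also have "\<dots> = 1" using assms pos by (simp flip: AP BR)
    finally have "(\<Sum>j\<in>F. a j * b j) / (A * B) \<le> 1"
      by (simp add: sum_divide_distrib)
    then show ?thesis using pos by (simp add: A_def[symmetric] B_def[symmetric])
  qed
qed

lemma Hoelder_fin_seq:
  assumes "1 \<le> p"
  shows "(\<Sum>j<N. \<bar>b j * a j\<bar>) \<le> p_norm (conj_exp p) (fin_seq N b) * p_norm p (fin_seq N a)"
using assms proof (cases rule: conj_exp_cases)
  case one
  have "\<bar>b j\<bar> \<le> p_norm \<infinity> (fin_seq N b)" if "j < N" for j
    using that by (rule abs_le_p_norm_top_fin_seq)
  then have "(\<Sum>j<N. \<bar>b j * a j\<bar>) \<le> (\<Sum>j<N. p_norm \<infinity> (fin_seq N b) * \<bar>a j\<bar>)"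
    by (intro sum_mono) (simp add: abs_mult mult_right_mono)
  with one show ?thesis by (simp add: p_norm_fin_seq_1 sum_distrib_left)
next
  case top
  have "\<bar>a j\<bar> \<le> p_norm \<infinity> (fin_seq N a)" if "j < N" for j
    using that by (rule abs_le_p_norm_top_fin_seq)
  then have "(\<Sum>j<N. \<bar>b j * a j\<bar>) \<le> (\<Sum>j<N. \<bar>b j\<bar> * p_norm \<infinity> (fin_seq N a))"
    by (intro sum_mono) (simp add: abs_mult mult_left_mono)
  with top show ?thesis by (simp add: p_norm_fin_seq_1 sum_distrib_right)
next
  case (real P R)
  with Hoelder_sum_real[of R P "{..<N}" "\<lambda>j. \<bar>b j\<bar>" "\<lambda>j. \<bar>a j\<bar>"] show ?thesis
    by (simp add: p_norm_fin_seq abs_mult add.commute)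
qed

lemma Hoelder:
  assumes p: "1 \<le> p" and b: "p_summable (conj_exp p) b" and a: "p_summable p a"
  shows "summable (\<lambda>j. \<bar>b j * a j\<bar>)"
    and "(\<Sum>j. \<bar>b j * a j\<bar>) \<le> p_norm (conj_exp p) b * p_norm p a"
proof -
  have le: "(\<Sum>j<N. \<bar>b j * a j\<bar>) \<le> p_norm (conj_exp p) b * p_norm p a" for N
    using Hoelder_fin_seq[OF p, of b a N]
    by (rule order_trans) (intro mult_mono p_norm_fin_seq_le p_norm_nonneg a b, simp)
  show "summable (\<lambda>j. \<bar>b j * a j\<bar>)"
    by (rule bounded_imp_summable[where B = "p_norm (conj_exp p) b * p_norm p a"])
      (auto simp: le simp flip: lessThan_Suc_atMost simp del: sum.lessThan_Suc)
  then show "(\<Sum>j. \<bar>b j * a j\<bar>) \<le> p_norm (conj_exp p) b * p_norm p a"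
    by (intro suminf_le_const le)
qed

text \<open>The extremal sequence is explicit: a single sign at an index of maximal
  \<open>\<bar>b j\<bar>\<close> for \<open>p = 1\<close>, all signs for
  \<open>p = \<infinity>\<close>, and a multiple of
  \<open>sgn (b j) * \<bar>b j\<bar> powr (R - 1)\<close> in between. Truncation to \<open>N\<close>
  terms guarantees that the maximum exists for \<open>p = 1\<close>.\<close>

lemma Hoelder_attained:
  assumes p: "1 \<le> p"
  obtains a where "p_norm p (fin_seq N a) \<le> 1"
    "(\<Sum>j<N. a j * b j) = p_norm (conj_exp p) (fin_seq N b)"
proof (cases "\<forall>j<N. b j = 0")
  case True
  then have "fin_seq N b = (\<lambda>_. 0)" "fin_seq N (\<lambda>_. 0::real) = (\<lambda>_. 0)" by (auto simp: fin_seq_def)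
  with True show ?thesis by (intro that[of "\<lambda>_. 0"]) simp_all
next
  case False
  \<comment> \<open>A nonzero term provides both a nonempty index set for the maximum and, later, a
    positive sum \<open>S\<close> to normalize by.\<close>
  then have N: "{..<N} \<noteq> {}" by auto
  show ?thesis
  using p proof (cases rule: conj_exp_cases)
    case one
    obtain i where i: "i < N" "\<And>j. j < N \<Longrightarrow> \<bar>b j\<bar> \<le> \<bar>b i\<bar>"
      using obtains_MAX[OF finite_lessThan N, of "\<lambda>j. \<bar>b j\<bar>"] Max_ge[of "(\<lambda>j. \<bar>b j\<bar>) ` {..<N}"]
      by (metis finite_imageI finite_lessThan imageI lessThan_iff)
    define a where "a j = (if j = i then sgn (b i) else 0)" for j
    have "(\<Sum>j<N. \<bar>a j\<bar>) = (\<Sum>j\<in>{i}. \<bar>a j\<bar>)"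
      by (rule sum.mono_neutral_right) (use i in \<open>auto simp: a_def\<close>)
    then have "p_norm p (fin_seq N a) \<le> 1"
      using one by (simp add: p_norm_fin_seq_1 a_def sgn_if)
    moreover have "(\<Sum>j<N. a j * b j) = (\<Sum>j\<in>{i}. a j * b j)"
      by (rule sum.mono_neutral_right) (use i in \<open>auto simp: a_def\<close>)
    then have "(\<Sum>j<N. a j * b j) = \<bar>b i\<bar>" by (simp add: a_def abs_sgn mult.commute)
    moreover have "p_norm \<infinity> (fin_seq N b) = \<bar>b i\<bar>"
    proof (rule antisym)
      show "p_norm \<infinity> (fin_seq N b) \<le> \<bar>b i\<bar>" using i by (intro p_norm_top_fin_seq) auto
      show "\<bar>b i\<bar> \<le> p_norm \<infinity> (fin_seq N b)"
        using i(1) by (rule abs_le_p_norm_top_fin_seq)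
    qed
    ultimately show ?thesis using one by (intro that[of a]) simp_all
  next
    case top
    have "p_norm p (fin_seq N (\<lambda>j. sgn (b j))) \<le> 1"
      unfolding top(1) by (intro p_norm_top_fin_seq) (auto simp: sgn_if)
    moreover have "(\<Sum>j<N. sgn (b j) * b j) = p_norm (conj_exp p) (fin_seq N b)"
      using top by (simp add: p_norm_fin_seq_1 abs_sgn mult.commute)
    ultimately show ?thesis by (rule that)
  next
    case (real P R)
    define S where "S = (\<Sum>j<N. \<bar>b j\<bar> powr R)"
    \<comment> \<open>Since \<open>(R - 1) * P = R\<close>, the numbers
      \<open>\<bar>a j\<bar> powr P\<close> sum to \<open>c powr P * S\<close>, which this exponent
      makes 1; then \<open>c * S = S powr (1 / R)\<close> is the conjugate norm of
      \<open>b\<close>.\<close>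
    define c where "c = S powr (- 1 / P)"
    define a where "a j = c * sgn (b j) * \<bar>b j\<bar> powr (R - 1)" for j
    have S: "S > 0"
    proof -
      from False obtain j where "j < N" "b j \<noteq> 0" by auto
      then show ?thesis unfolding S_def by (intro sum_pos2[of _ j]) auto
    qed
    have RP: "(R - 1) * P = R" using real by (simp add: field_simps)
    have "\<bar>a j\<bar> powr P = \<bar>b j\<bar> powr R / S" for j
    proof (cases "b j = 0")
      case False
      then have "\<bar>a j\<bar> = c * \<bar>b j\<bar> powr (R - 1)" using S by (simp add: a_def abs_mult c_def abs_sgn_eq)
      then have "\<bar>a j\<bar> powr P = c powr P * \<bar>b j\<bar> powr R"
        using RP by (simp add: powr_mult powr_powr c_def)
      also have "c powr P = 1 / S" using real S unfolding c_def powr_powr by (simp add: powr_minus_divide)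
      finally show ?thesis by simp
    qed (simp add: a_def)
    then have "(\<Sum>j<N. \<bar>a j\<bar> powr P) = 1" using S by (simp add: S_def flip: sum_divide_distrib)
    then have norm: "p_norm p (fin_seq N a) \<le> 1" using real by (simp add: p_norm_fin_seq)
    have "a j * b j = c * \<bar>b j\<bar> powr R" for j
    proof (cases "b j = 0")
      case False
      have "a j * b j = c * (\<bar>b j\<bar> powr (R - 1) * \<bar>b j\<bar>)"
        by (simp add: a_def abs_sgn mult.commute mult.left_commute)
      also have "\<bar>b j\<bar> powr (R - 1) * \<bar>b j\<bar> = \<bar>b j\<bar> powr R"
        using False by (simp add: powr_mult_base mult.commute)
      finally show ?thesis .
    qed (simp add: a_def)
    then have "(\<Sum>j<N. a j * b j) = c * S" by (simp add: S_def sum_distrib_left)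
    also have "c * S = S powr (1 - 1 / P)" using S by (simp add: c_def powr_diff powr_minus_divide)
    also have "1 - 1 / P = 1 / R" using real by simp
    finally have "(\<Sum>j<N. a j * b j) = p_norm (conj_exp p) (fin_seq N b)"
      using real by (simp add: p_norm_fin_seq S_def)
    with norm show ?thesis by (rule that)
  qed
qed

subsection \<open>Consequences of the Baire category theorem\<close>

text \<open>Baire's theorem: if every \<open>F n\<close> had empty interior, so would the union,
  which is the whole space.\<close>

lemma closed_cover_has_interior:
  fixes F :: "nat \<Rightarrow> 'a::banach set"
  assumes "\<And>n. closed (F n)" "(\<Union>n. F n) = UNIV"
  obtains n x r where "0 < r" "cball x r \<subseteq> F n"
proof -
  have "\<exists>n. interior (F n) \<noteq> {}"
  proof (rule ccontr)
    assume "\<not> ?thesis"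
    then have "Met_TC.mtopology interior_of \<Union>(range F) = {}"
      using assms(1)
      by (intro Met_TC.metric_Baire_category_alt)
        (auto simp: mcomplete_iff_complete complete_UNIV interior_of_eq_empty)
    then show False using assms(2) by simp
  qed
  then obtain n x where "x \<in> interior (F n)" by blast
  then obtain r where "0 < r" "cball x r \<subseteq> F n"
    using mem_interior_cball by blast
  then show ?thesis by (rule that)
qed

text \<open>The estimate \<open>q\<^sub>i(x - y) \<le> c (q\<^sub>i x + q\<^sub>i y)\<close> allows \<open>q\<^sub>i\<close> to be a power of a seminorm, so that
  Minkowski's inequality is not needed in applications.\<close>

lemma uniform_boundedness:
  fixes q :: "'i \<Rightarrow> 'a::banach \<Rightarrow> real"
  assumes cont: "\<And>i. continuous_on UNIV (q i)"
    and diff: "\<And>i x y. q i (x - y) \<le> c * (q i x + q i y)" and c: "0 \<le> c"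
    and bounded: "\<And>x. \<exists>M. \<forall>i. q i x \<le> M"
  obtains r M where "0 < r" "\<And>i x. norm x \<le> r \<Longrightarrow> q i x \<le> M"
proof -
  define F where "F n = {x. \<forall>i. q i x \<le> real n}" for n
  have "F n = (\<Inter>i. {x. q i x \<le> real n})" for n by (auto simp: F_def)
  then have "closed (F n)" for n
    using cont by (auto intro!: closed_INT closed_Collect_le continuous_on_const)
  moreover have "(\<Union>n. F n) = UNIV"
  proof -
    have "x \<in> (\<Union>n. F n)" for x
    proof -
      obtain M where "\<forall>i. q i x \<le> M" using bounded by blast
      moreover obtain n where "M \<le> real n" using real_arch_simple by blast
      ultimately show ?thesis unfolding F_def by (auto intro: order_trans)
    qed
    then show ?thesis by blast
  qed
  ultimately obtain n x r where r: "0 < r" "cball x r \<subseteq> F n"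
    by (rule closed_cover_has_interior)
  show ?thesis
  proof (rule that[OF r(1)])
    fix i z :: 'a assume "norm z \<le> r"
    \<comment> \<open>Writing \<open>z\<close> as \<open>(x + z) - x\<close> moves the bound from
      the ball around \<open>x\<close> to the ball around 0.\<close>
    then have "x + z \<in> F n" "x \<in> F n" using r by (auto simp: dist_norm)
    then have "q i (x + z) \<le> real n" "q i x \<le> real n" for i by (auto simp: F_def)
    then have "q i (x + z) + q i x \<le> 2 * real n" for i by (smt (verit))
    then have "c * (q i (x + z) + q i x) \<le> c * (2 * real n)" for i using c by (rule mult_left_mono)
    then show "q i z \<le> c * (2 * real n)" for i using diff[of i "x + z" x] by (force intro: order_trans)
  qed
qed

text \<open>The sublevel sets of \<open>q\<close> need not be closed, so Baire's theorem is applied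
  to their closures. It shows only that every vector can be approximated by vectors with controlled
  \<open>q\<close>; iterating on the remainder writes the vector as an absolutely convergent series,
  and countable subadditivity transfers the control to the vector itself.\<close>

lemma Zabreiko:
  fixes q :: "'a::banach \<Rightarrow> real"
  assumes nonneg: "\<And>x. 0 \<le> q x"
    and scale: "\<And>c x. q (c *\<^sub>R x) \<le> \<bar>c\<bar> * q x"
    and subadd: "\<And>x. summable (\<lambda>k. norm (x k)) \<Longrightarrow> summable (\<lambda>k. q (x k)) \<Longrightarrow> q (\<Sum>k. x k) \<le> (\<Sum>k. q (x k))"
  shows "\<exists>M\<ge>0. \<forall>x. q x \<le> M * norm x"
proof -
  have q0: "q 0 = 0" using scale[of 0 0] nonneg[of 0] by simp
  have add: "q (x + y) \<le> q x + q y" for x y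
  proof -
    \<comment> \<open>Finite subadditivity is the countable one for a series with at most two
      nonzero terms, since \<open>q 0 = 0\<close>.\<close>
    define f where "f k = (if k = 0 then x else if k = 1 then y else 0)" for k :: nat
    have s: "(\<Sum>k. h (f k)) = h x + h y" "summable (\<lambda>k. h (f k))" if "h 0 = 0" for h :: "'a \<Rightarrow> 'b::real_normed_vector"
    proof -
      have "(\<lambda>k. h (f k)) sums (\<Sum>k\<in>{0,1}. h (f k))"
        by (rule sums_finite) (auto simp: f_def that)
      then show "(\<Sum>k. h (f k)) = h x + h y" "summable (\<lambda>k. h (f k))" by (auto simp: sums_iff f_def)
    qed
    show ?thesis using subadd[of f] s[of norm] s[of q] s[of "\<lambda>x. x"] q0 by simp
  qed
  have "(\<Union>n. closure {x. q x \<le> real n}) = UNIV"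
    using real_arch_simple closure_subset by (fastforce simp: set_eq_iff)
  then obtain n x r where r: "0 < r" "cball x r \<subseteq> closure {x. q x \<le> real n}"
    by (rule closed_cover_has_interior[rotated]) auto
  \<comment> \<open>\<open>K\<close> is the value of \<open>q\<close> paid per unit of norm when a
    vector is approximated.\<close>
  define K where "K = real n / r"
  have K: "0 \<le> K" using r by (simp add: K_def)
  have approx: "\<exists>a. q a \<le> K * d \<and> norm (z - a) < e" if "norm z \<le> d" "0 < d" "0 < e" for z d e
  proof -
    define z' where "z' = (r / d) *\<^sub>R z"
    define e' where "e' = e * r / d"
    have "norm z' \<le> r" using that r(1) by (simp add: z'_def field_simps)
    then have "x + z' \<in> closure {x. q x \<le> real n}" "x - z' \<in> closure {x. q x \<le> real n}"
      using r(2) by (auto simp: dist_norm)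
    moreover have "e' > 0" using that r by (simp add: e'_def)
    ultimately obtain a b where a: "q a \<le> real n" "dist a (x + z') < e'"
      and b: "q b \<le> real n" "dist b (x - z') < e'"
      by (fastforce simp: closure_approachable)
    \<comment> \<open>As \<open>a\<close> is near \<open>x + z'\<close> and \<open>b\<close> is near
      \<open>x - z'\<close>, half their difference is near \<open>z'\<close>: the unknown centre
      \<open>x\<close> cancels. The bound \<open>n\<close> on \<open>q\<close> survives because
      \<open>q\<close> is symmetric and subadditive.\<close>
    define w where "w = (1 / 2) *\<^sub>R (a - b)"
    have "q (a - b) \<le> q a + \<bar>-1\<bar> * q b"
      using add[of a "(-1) *\<^sub>R b"] scale[of "-1" b] by simp
    then have "q w \<le> real n" using a b scale[of "1/2" "a - b"] by (simp add: w_def)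
    moreover have "norm (z' - w) < e'"
    proof -
      have "z' - w = (1 / 2) *\<^sub>R ((x + z' - a) - (x - z' - b))"
        by (simp add: w_def algebra_simps flip: scaleR_add_left)
      then have "norm (z' - w) = norm ((x + z' - a) - (x - z' - b)) / 2" by simp
      also have "\<dots> \<le> (norm (x + z' - a) + norm (x - z' - b)) / 2"
        by (intro divide_right_mono norm_triangle_ineq4) auto
      also have "\<dots> < e'" using a b by (simp add: dist_norm norm_minus_commute)
      finally show ?thesis .
    qed
    moreover have "norm (z - (d / r) *\<^sub>R w) = (d / r) * norm (z' - w)"
    proof -
      have "z - (d / r) *\<^sub>R w = (d / r) *\<^sub>R (z' - w)"
        using that r by (simp add: z'_def scaleR_diff_right)
      then show ?thesis using that r by simp
    qed
    moreover have "(d / r) * norm (z' - w) < e"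
      using \<open>norm (z' - w) < e'\<close> that r by (simp add: e'_def field_simps)
    moreover have "q ((d / r) *\<^sub>R w) \<le> (d / r) * real n"
    proof -
      have "q ((d / r) *\<^sub>R w) \<le> (d / r) * q w" using scale[of "d / r" w] that r by simp
      also have "\<dots> \<le> (d / r) * real n" using \<open>q w \<le> real n\<close> that r by (intro mult_left_mono) auto
      finally show ?thesis .
    qed
    ultimately have "q ((d / r) *\<^sub>R w) \<le> (d / r) * real n \<and> norm (z - (d / r) *\<^sub>R w) < e"
      by simp
    then have "q ((d / r) *\<^sub>R w) \<le> K * d \<and> norm (z - (d / r) *\<^sub>R w) < e"
      by (simp add: K_def mult.commute)
    then show ?thesis by blast
  qed
  have ball: "q z \<le> 2 * K" if z: "norm z \<le> 1" for z
  proof -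
    \<comment> \<open>Successive correction: at stage \<open>k\<close> a remainder of norm at most
      \<open>(1 / 2) ^ k\<close> is approximated up to half that size, at \<open>q\<close>-cost at
      most \<open>K * (1 / 2) ^ k\<close>. The costs add up to at most \<open>2 * K\<close>.\<close>
    define a where "a y k = (SOME a. q a \<le> K * (1 / 2) ^ k \<and> norm (y - a) < (1 / 2) ^ Suc k)" for y k
    have a: "q (a y k) \<le> K * (1 / 2) ^ k \<and> norm (y - a y k) < (1 / 2) ^ Suc k"
      if "norm y \<le> (1 / 2) ^ k" for y k
      unfolding a_def by (rule someI_ex) (rule approx[OF that], simp_all)
    define y where "y = rec_nat z (\<lambda>k y. y - a y k)"
    have y0: "y 0 = z" and yS: "y (Suc k) = y k - a (y k) k" for k by (simp_all add: y_def)
    have ny: "norm (y k) \<le> (1 / 2) ^ k" for k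
    proof (induction k)
      case 0
      then show ?case using z by (simp add: y0)
    next
      case (Suc k)
      then show ?case unfolding yS using a[of "y k" k] by (simp add: less_imp_le)
    qed
    define b where "b k = a (y k) k" for k
    have qb: "q (b k) \<le> K * (1 / 2) ^ k" for k using a ny by (simp add: b_def)
    have bk: "b k = y k - y (Suc k)" for k by (simp add: b_def yS)
    have "norm (b k) \<le> 2 * (1 / 2) ^ k" for k
    proof -
      have "norm (b k) \<le> norm (y k) + norm (y (Suc k))" unfolding bk by (rule norm_triangle_ineq4)
      also have "\<dots> \<le> 2 * (1 / 2) ^ k"
      proof -
        have "norm (y (Suc k)) \<le> (1 / 2) ^ k"
          using ny[of "Suc k"] by (rule order_trans) (simp add: power_decreasing)
        with ny[of k] show ?thesis by linarith
      qed
      finally show ?thesis .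
    qed
    then have nb: "summable (\<lambda>k. norm (b k))"
      by (intro summable_comparison_test'[OF summable_mult[OF summable_geometric], of "1 / 2" 0 _ 2]) auto
    have sq: "summable (\<lambda>k. q (b k))"
      using qb nonneg
      by (intro summable_comparison_test'[OF summable_mult[OF summable_geometric], of "1 / 2" 0 _ K]) auto
    have "(\<lambda>k. (1 / 2 :: real) ^ k) \<longlonglongrightarrow> 0" by (rule LIMSEQ_power_zero) simp
    then have "y \<longlonglongrightarrow> 0" by (rule Lim_null_comparison[rotated]) (use ny in auto)
    then have "(\<lambda>k. y k - y (Suc k)) sums (y 0 - 0)" by (rule telescope_sums')
    then have "(\<Sum>k. b k) = z" by (simp add: bk sums_iff y0)
    then have "q z \<le> (\<Sum>k. q (b k))" using subadd[OF nb sq] by simp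
    also have "\<dots> \<le> (\<Sum>k. K * (1 / 2) ^ k)"
      using sq qb by (intro suminf_le summable_mult summable_geometric) auto
    also have "\<dots> = 2 * K" by (subst suminf_mult) (auto simp: suminf_geometric summable_geometric)
    finally show ?thesis .
  qed
  have "q z \<le> 2 * K * norm z" for z
  proof (cases "z = 0")
    case False
    have "q z \<le> norm z * q ((1 / norm z) *\<^sub>R z)"
      using scale[of "norm z" "(1 / norm z) *\<^sub>R z"] False by simp
    also have "\<dots> \<le> norm z * (2 * K)" using False by (intro mult_left_mono ball) auto
    finally show ?thesis by (simp add: mult.commute)
  qed (simp add: q0)
  then show ?thesis using K by (intro exI[of _ "2 * K"]) simp
qed

subsection \<open>Nuclear norms and traces\<close>

lemma infsum_eq_suminf:
  fixes f :: "nat \<Rightarrow> 'a::banach"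
  assumes "summable (\<lambda>n. norm (f n))"
  shows "infsum f UNIV = suminf f"
  by (rule infsumI[OF norm_summable_imp_has_sum[OF assms summable_sums[OF summable_norm_cancel[OF assms]]]])

text \<open>Absolute summability permits a detour through unordered sums over pairs: these are
  invariant under the bijection \<open>prod_decode\<close> and can be iterated, which links the
  enumerated series to the row-by-row sum.\<close>

lemma sums_prod_decode:
  fixes f :: "nat \<Rightarrow> nat \<Rightarrow> 'a::banach"
  assumes inner: "\<And>m. summable (\<lambda>n. norm (f m n))" and outer: "summable (\<lambda>m. \<Sum>n. norm (f m n))"
  shows "summable (\<lambda>i. norm (case_prod f (prod_decode i)))"
    and "(\<lambda>i. case_prod f (prod_decode i)) sums (\<Sum>m. \<Sum>n. f m n)"
proof -
  have eq: "(\<Sum>\<^sub>\<infinity>n. norm (f m n)) = (\<Sum>n. norm (f m n))" for m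
    using inner by (intro infsum_eq_suminf) simp
  have "(\<lambda>n. norm (f m n)) summable_on UNIV" for m
    using inner by (intro norm_summable_imp_summable_on) simp
  moreover have "(\<lambda>m. norm (\<Sum>\<^sub>\<infinity>n. norm (f m n))) summable_on UNIV"
    unfolding eq using outer by (intro norm_summable_imp_summable_on) (simp add: suminf_nonneg inner)
  ultimately have abs: "(\<lambda>z. norm (case_prod f z)) summable_on UNIV \<times> UNIV"
    unfolding Infinite_Sum.abs_summable_on_Sigma_iff prod.case by blast
  then have "(\<lambda>z. norm (case_prod f z)) summable_on UNIV" unfolding UNIV_Times_UNIV .
  then have "(\<lambda>i. norm (case_prod f (prod_decode i))) summable_on UNIV"
    by (rule summable_on_reindex_bij_betw[OF bij_prod_decode, THEN iffD2])
  then show "summable (\<lambda>i. norm (case_prod f (prod_decode i)))" by (rule summable_on_imp_summable)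
  have sum: "case_prod f summable_on UNIV \<times> UNIV"
    using abs by (rule Infinite_Sum.abs_summable_summable)
  then have "(case_prod f has_sum infsum (case_prod f) (UNIV \<times> UNIV)) UNIV"
    unfolding UNIV_Times_UNIV by (rule has_sum_infsum)
  then have "((\<lambda>i. case_prod f (prod_decode i)) has_sum infsum (case_prod f) (UNIV \<times> UNIV)) UNIV"
    by (rule has_sum_reindex_bij_betw[OF bij_prod_decode, THEN iffD2])
  then have "(\<lambda>i. case_prod f (prod_decode i)) sums infsum (case_prod f) (UNIV \<times> UNIV)"
    by (rule has_sum_imp_sums)
  also have "infsum (case_prod f) (UNIV \<times> UNIV) = (\<Sum>\<^sub>\<infinity>m. \<Sum>\<^sub>\<infinity>n. f m n)"
    using infsum_Sigma_banach[OF sum] unfolding prod.case by (rule sym)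
  also have "\<dots> = (\<Sum>\<^sub>\<infinity>m. \<Sum>n. f m n)"
    by (intro infsum_cong infsum_eq_suminf inner)
  also have "\<dots> = (\<Sum>m. \<Sum>n. f m n)"
  proof (rule infsum_eq_suminf)
    show "summable (\<lambda>m. norm (\<Sum>n. f m n))"
      by (rule summable_comparison_test'[OF outer, of 0]) (simp add: summable_norm inner)
  qed
  finally show "(\<lambda>i. case_prod f (prod_decode i)) sums (\<Sum>m. \<Sum>n. f m n)" .
qed

section \<open>The nuclear norm as a countably subadditive seminorm\<close>

lemma rank_one_apply [simp]: "blinfun_apply (rank_one \<phi> u) x = blinfun_apply \<phi> x *\<^sub>R u"
  by (simp add: rank_one_def)

lemma nuclear_norm_le:
  assumes "nuclear_rep U \<phi> u"
  shows "nuclear_norm U \<le> (\<Sum>n. norm (\<phi> n) * norm (u n))"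
  unfolding nuclear_norm_def
proof (rule cInf_lower)
  show "bdd_below {\<Sum>n. norm (\<phi> n) * norm (u n) | \<phi> u. nuclear_rep U \<phi> u}"
    by (rule bdd_belowI[of _ 0]) (auto simp: nuclear_rep_def intro!: suminf_nonneg)
qed (use assms in blast)

lemma nuclear_norm_greatest:
  assumes "U \<in> nuclear" "\<And>\<phi> u. nuclear_rep U \<phi> u \<Longrightarrow> C \<le> (\<Sum>n. norm (\<phi> n) * norm (u n))"
  shows "C \<le> nuclear_norm U"
  unfolding nuclear_norm_def
  by (rule cInf_greatest) (use assms in \<open>auto simp: nuclear_def\<close>)

lemma nuclear_norm_nonneg: "U \<in> nuclear \<Longrightarrow> 0 \<le> nuclear_norm U"
  by (rule nuclear_norm_greatest) (auto simp: nuclear_rep_def intro!: suminf_nonneg)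

lemma nuclear_norm_approx:
  assumes "U \<in> nuclear" "0 < e"
  obtains \<phi> u where "nuclear_rep U \<phi> u" "(\<Sum>n. norm (\<phi> n) * norm (u n)) < nuclear_norm U + e"
  using nuclear_norm_greatest[OF assms(1), of "nuclear_norm U + e"] assms(2) by force

lemma nuclear_rep_scale:
  assumes "nuclear_rep U \<phi> u"
  shows "nuclear_rep (c *\<^sub>R U) \<phi> (\<lambda>n. c *\<^sub>R u n)"
proof -
  have "(\<lambda>j. c *\<^sub>R (blinfun_apply (\<phi> j) x *\<^sub>R u j)) sums (c *\<^sub>R blinfun_apply U x)" for x
    using assms by (intro sums_scaleR_right) (simp add: nuclear_rep_def rank_one_series_def)
  moreover have "summable (\<lambda>n. \<bar>c\<bar> * (norm (\<phi> n) * norm (u n)))"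
    using assms by (intro summable_mult) (simp add: nuclear_rep_def)
  ultimately show ?thesis
    by (simp add: nuclear_rep_def rank_one_series_def scaleR_blinfun.rep_eq mult.left_commute mult.commute[of _ c])
qed

lemma nuclear_norm_scale:
  assumes "U \<in> nuclear"
  shows "nuclear_norm (c *\<^sub>R U) \<le> \<bar>c\<bar> * nuclear_norm U"
proof (rule field_le_epsilon)
  fix e :: real assume "0 < e"
  then have "0 < e / (\<bar>c\<bar> + 1)" by simp
  with assms obtain \<phi> u where rep: "nuclear_rep U \<phi> u"
    and less: "(\<Sum>n. norm (\<phi> n) * norm (u n)) < nuclear_norm U + e / (\<bar>c\<bar> + 1)"
    by (rule nuclear_norm_approx)
  have "nuclear_norm (c *\<^sub>R U) \<le> (\<Sum>n. \<bar>c\<bar> * (norm (\<phi> n) * norm (u n)))"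
    using nuclear_norm_le[OF nuclear_rep_scale[OF rep, of c]] by (simp add: mult.left_commute)
  also have "\<dots> = \<bar>c\<bar> * (\<Sum>n. norm (\<phi> n) * norm (u n))"
    using rep by (intro suminf_mult) (simp add: nuclear_rep_def)
  also have "\<dots> \<le> \<bar>c\<bar> * (nuclear_norm U + e / (\<bar>c\<bar> + 1))"
    using less by (intro mult_left_mono) auto
  also have "\<dots> \<le> \<bar>c\<bar> * nuclear_norm U + e"
    using \<open>0 < e\<close> by (simp add: field_simps)
  finally show "nuclear_norm (c *\<^sub>R U) \<le> \<bar>c\<bar> * nuclear_norm U + e" .
qed

text \<open>Almost optimal representations of the \<open>V m\<close>, with errors \<open>d m\<close>
  of total \<open>e\<close>, are concatenated along \<open>prod_decode\<close> into one
  representation of \<open>U\<close>. This is the countable subadditivity that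
  \<open>Zabreiko\<close> demands.\<close>

lemma nuclear_norm_suminf:
  fixes U :: "'a::real_normed_vector \<Rightarrow>\<^sub>L 'b::banach"
  assumes nuc: "\<And>m. V m \<in> nuclear" and sm: "summable (\<lambda>m. nuclear_norm (V m))"
    and U: "\<And>x. (\<lambda>m. blinfun_apply (V m) x) sums blinfun_apply U x"
  shows "nuclear_norm U \<le> (\<Sum>m. nuclear_norm (V m))"
proof (rule field_le_epsilon)
  fix e :: real assume e: "0 < e"
  define d where "d m = e * (1 / 2) ^ Suc m" for m
  have d: "d sums e" "\<And>m. 0 < d m"
    using sums_mult[OF power_half_series, of e] e by (simp_all add: d_def[abs_def])
  have "\<forall>m. \<exists>\<phi> u. nuclear_rep (V m) \<phi> u \<and> (\<Sum>n. norm (\<phi> n) * norm (u n)) < nuclear_norm (V m) + d m"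
    using nuclear_norm_approx nuc d(2) by metis
  then obtain \<phi> u where rep: "\<And>m. nuclear_rep (V m) (\<phi> m) (u m)"
    and less: "\<And>m. (\<Sum>n. norm (\<phi> m n) * norm (u m n)) < nuclear_norm (V m) + d m" by metis
  have inner: "summable (\<lambda>n. norm (\<phi> m n) * norm (u m n))" for m
    using rep by (simp add: nuclear_rep_def)
  have bound: "summable (\<lambda>m. nuclear_norm (V m) + d m)"
    using sm d by (intro summable_add) (auto simp: sums_iff)
  have outer: "summable (\<lambda>m. \<Sum>n. norm (\<phi> m n) * norm (u m n))"
    by (rule summable_comparison_test'[OF bound, of 0]) (use less inner in \<open>auto simp: suminf_nonneg less_imp_le\<close>)
  define \<phi>' where "\<phi>' i = case_prod \<phi> (prod_decode i)" for i
  define u' where "u' i = case_prod u (prod_decode i)" for i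
  have norms: "norm (\<phi>' i) * norm (u' i) = (case prod_decode i of (m, n) \<Rightarrow> norm (\<phi> m n) * norm (u m n))" for i
    by (simp add: \<phi>'_def u'_def split: prod.split)
  have total: "(\<lambda>i. norm (\<phi>' i) * norm (u' i)) sums (\<Sum>m. \<Sum>n. norm (\<phi> m n) * norm (u m n))"
    unfolding norms
    using sums_prod_decode(2)[of "\<lambda>m n. norm (\<phi> m n) * norm (u m n)"] inner outer by simp
  have "nuclear_rep U \<phi>' u'"
    unfolding nuclear_rep_def rank_one_series_def
  proof (intro conjI allI)
    show "summable (\<lambda>i. norm (\<phi>' i) * norm (u' i))" using total by (simp add: sums_iff)
    fix x
    define f where "f m n = blinfun_apply (\<phi> m n) x *\<^sub>R u m n" for m n
    \<comment> \<open>At each \<open>x\<close> the values are dominated by the summable norm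
      products, so the concatenated series can be summed row by row, and row \<open>m\<close> gives
      \<open>V m\<close>.\<close>
    have le: "norm (f m n) \<le> norm x * (norm (\<phi> m n) * norm (u m n))" for m n
      using mult_right_mono[OF norm_blinfun[of "\<phi> m n" x], of "norm (u m n)"]
      by (simp add: f_def mult_ac)
    have f1: "summable (\<lambda>n. norm (f m n))" for m
      by (rule summable_comparison_test'[OF summable_mult[OF inner], of 0]) (use le in simp)
    have "(\<Sum>n. norm (f m n)) \<le> norm x * (\<Sum>n. norm (\<phi> m n) * norm (u m n))" for m
      using suminf_le[OF le f1 summable_mult[OF inner]] suminf_mult[OF inner] by simp
    then have "summable (\<lambda>m. \<Sum>n. norm (f m n))"
      by (intro summable_comparison_test'[OF summable_mult[OF outer], of 0])
        (simp add: suminf_nonneg f1)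
    from sums_prod_decode(2)[OF f1 this]
    have "(\<lambda>i. case_prod f (prod_decode i)) sums (\<Sum>m. \<Sum>n. f m n)" .
    moreover have "(\<Sum>n. f m n) = blinfun_apply (V m) x" for m
      using rep by (auto simp: nuclear_rep_def rank_one_series_def f_def sums_iff)
    moreover have "case_prod f (prod_decode i) = blinfun_apply (rank_one (\<phi>' i) (u' i)) x" for i
      by (simp add: f_def \<phi>'_def u'_def split: prod.split)
    ultimately show "(\<lambda>i. blinfun_apply (rank_one (\<phi>' i) (u' i)) x) sums blinfun_apply U x"
      using U[of x] by (simp add: sums_iff)
  qed
  then have "nuclear_norm U \<le> (\<Sum>m. \<Sum>n. norm (\<phi> m n) * norm (u m n))"
    using nuclear_norm_le[of U \<phi>' u'] total by (simp add: sums_iff)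
  also have "\<dots> \<le> (\<Sum>m. nuclear_norm (V m) + d m)"
    using less outer bound by (intro suminf_le) (auto intro: less_imp_le)
  also have "\<dots> = (\<Sum>m. nuclear_norm (V m)) + e"
    using suminf_add[of "\<lambda>m. nuclear_norm (V m)" d] sm d by (simp add: sums_iff)
  finally show "nuclear_norm U \<le> (\<Sum>m. nuclear_norm (V m)) + e" .
qed

section \<open>Finite-dimensional subspaces and coordinates of finite rank operators\<close>

lemma coordinate_bound:
  fixes e :: "'a::real_normed_vector"
  assumes "y \<in> span M"
  shows "\<bar>a\<bar> * infdist e (span M) \<le> norm (a *\<^sub>R e + y)"
proof (cases "a = 0")
  case False
  \<comment> \<open>Division by \<open>a\<close> turns the vector into \<open>e\<close> minus a
    point of the span, whose norm is at least the distance of \<open>e\<close> from the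
    span.\<close>
  have "- ((1 / a) *\<^sub>R y) \<in> span M" using assms by (intro span_neg span_scale)
  then have "infdist e (span M) \<le> norm (e + (1 / a) *\<^sub>R y)"
    by (auto simp: dist_norm dest: infdist_le[where x = e])
  then have "\<bar>a\<bar> * infdist e (span M) \<le> norm (a *\<^sub>R (e + (1 / a) *\<^sub>R y))"
    by (simp add: mult_left_mono)
  with False show ?thesis by (simp add: scaleR_add_right)
qed simp

lemma infdist_span_pos:
  fixes e :: "'a::real_normed_vector"
  assumes "closed (span M)" "e \<notin> span M"
  shows "0 < infdist e (span M)"
  using assms infdist_pos_not_in_closed span_zero by blast

text \<open>Induction on the spanning set. A new vector \<open>e\<close> outside the closed
  \<open>span M\<close> has positive distance from it, so \<open>coordinate_bound\<close> makes the
  coordinates along \<open>e\<close> of a convergent sequence a Cauchy sequence of reals;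
  subtracting that part leaves a convergent sequence in \<open>span M\<close>.\<close>

lemma closed_span_finite:
  fixes B :: "'a::real_normed_vector set"
  assumes "finite B"
  shows "closed (span B)"
  using assms
proof (induction B)
  case (insert e M)
  show ?case
  proof (cases "e \<in> span M")
    case True
    then show ?thesis using insert by (simp add: span_redundant)
  next
    case False
    define d where "d = infdist e (span M)"
    have d: "0 < d" unfolding d_def using insert.IH False by (rule infdist_span_pos)
    show ?thesis
      unfolding closed_sequential_limits
    proof (intro allI impI, elim conjE)
      fix x z assume x: "\<forall>n. x n \<in> span (insert e M)" and lim: "x \<longlonglongrightarrow> z"
      have "\<forall>n. \<exists>k. x n - k *\<^sub>R e \<in> span M"
        using x unfolding span_breakdown_eq .
      then obtain k where "\<forall>n. x n - k n *\<^sub>R e \<in> span M" by (rule choice[THEN exE])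
      then have k: "x n - k n *\<^sub>R e \<in> span M" for n ..
      have kd: "\<bar>k m - k n\<bar> * d \<le> norm (x m - x n)" for m n
      proof -
        have "(k m - k n) *\<^sub>R e + ((x m - k m *\<^sub>R e) - (x n - k n *\<^sub>R e)) = x m - x n"
          by (simp add: scaleR_diff_left)
        with coordinate_bound[OF span_diff[OF k[of m] k[of n]], of "k m - k n" e]
        show ?thesis by (simp only: d_def)
      qed
      have "Cauchy k"
      proof (rule metric_CauchyI)
        fix r :: real assume "0 < r"
        then have "0 < r * d" using d by simp
        from metric_CauchyD[OF LIMSEQ_imp_Cauchy[OF lim] this]
        obtain N where N: "\<forall>m\<ge>N. \<forall>n\<ge>N. dist (x m) (x n) < r * d" ..
        have "dist (k m) (k n) < r" if "m \<ge> N" "n \<ge> N" for m n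
        proof -
          have "dist (k m) (k n) * d < r * d"
            using kd[of m n] N that by (auto simp: dist_real_def dist_norm intro: le_less_trans)
          then show ?thesis using d by simp
        qed
        then show "\<exists>N. \<forall>m\<ge>N. \<forall>n\<ge>N. dist (k m) (k n) < r" by blast
      qed
      then obtain l where "k \<longlonglongrightarrow> l" unfolding Cauchy_convergent_iff convergent_def ..
      then have "(\<lambda>n. x n - k n *\<^sub>R e) \<longlonglongrightarrow> z - l *\<^sub>R e"
        by (intro tendsto_intros lim)
      then have "z - l *\<^sub>R e \<in> span M"
        using closed_sequentially[OF insert.IH, of "\<lambda>n. x n - k n *\<^sub>R e"] k by simp
      then show "z \<in> span (insert e M)" unfolding span_breakdown_eq by blast
    qed
  qed
qed simp

text \<open>The coordinates with respect to a basis of a finite-dimensional space containing the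
  range are continuous, because each basis vector has positive distance from the closed span of the
  others.\<close>

lemma finite_rank_decomposition:
  fixes R :: "'a::real_normed_vector \<Rightarrow>\<^sub>L 'b::real_normed_vector"
  assumes "finite_rank R"
  obtains B :: "'b set" and s :: "'b \<Rightarrow> 'a \<Rightarrow>\<^sub>L real"
  where "finite B" "\<And>x. blinfun_apply R x = (\<Sum>b\<in>B. blinfun_apply (s b) x *\<^sub>R b)"
proof -
  obtain B0 where B0: "finite B0" "range (blinfun_apply R) \<subseteq> span B0"
    using assms by (auto simp: finite_rank_def)
  obtain B where B: "B \<subseteq> B0" "independent B" "B0 \<subseteq> span B"
    using maximal_independent_subset[of B0] by blast
  have fin: "finite B" using B B0 finite_subset by blast
  have ran: "blinfun_apply R x \<in> span B" for x
    using B0(2) span_minimal[OF B(3) subspace_span] by blast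
  define t where "t b x = representation B (blinfun_apply R x) b" for b x
  have R: "blinfun_apply R x = (\<Sum>b\<in>B. t b x *\<^sub>R b)" for x
    unfolding t_def using B(2) fin ran by (simp add: sum_representation_eq)
  have bl: "bounded_linear (t b)" if b: "b \<in> B" for b
  proof -
    define d where "d = infdist b (span (B - {b}))"
    have d: "0 < d"
      unfolding d_def
      using B(2) b fin by (intro infdist_span_pos closed_span_finite) (auto simp: dependent_def)
    show ?thesis
    proof (rule bounded_linear_intro)
      fix x y :: 'a and r :: real
      show "t b (x + y) = t b x + t b y"
        by (simp add: t_def blinfun.add_right representation_add B ran)
      show "t b (r *\<^sub>R x) = r *\<^sub>R t b x"
        by (simp add: t_def blinfun.scaleR_right representation_scale B ran)
      have "blinfun_apply R x = t b x *\<^sub>R b + (\<Sum>c\<in>B - {b}. t c x *\<^sub>R c)"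
        unfolding R using fin b by (rule sum.remove)
      moreover have "(\<Sum>c\<in>B - {b}. t c x *\<^sub>R c) \<in> span (B - {b})"
        by (intro span_sum span_scale span_base)
      ultimately have "\<bar>t b x\<bar> * d \<le> norm (blinfun_apply R x)"
        using coordinate_bound[of "\<Sum>c\<in>B - {b}. t c x *\<^sub>R c" "B - {b}" "t b x" b] by (simp add: d_def)
      also have "\<dots> \<le> norm R * norm x" by (rule norm_blinfun)
      finally show "norm (t b x) \<le> norm x * (norm R / d)" using d by (simp add: field_simps)
    qed
  qed
  show ?thesis
    by (rule that[OF fin, of "\<lambda>b. Blinfun (t b)"]) (simp add: R bounded_linear_Blinfun_apply bl)
qed

text \<open>With the tails \<open>t\<^sub>n = \<Sum>m\<ge>n. (a\<^sub>m + 2\<^sup>-\<^sup>m)\<close> and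
  \<open>w\<^sub>n = \<surd>t\<^sub>n + \<surd>t\<^sub>n\<^sub>+\<^sub>1\<close>, the series \<open>\<Sum>n. (t\<^sub>n - t\<^sub>n\<^sub>+\<^sub>1) / w\<^sub>n\<close> telescopes.\<close>

lemma summable_divide_null_sequence:
  fixes a :: "nat \<Rightarrow> real"
  assumes "summable a" "\<And>n. 0 \<le> a n"
  shows "\<exists>w. (\<forall>n. 0 < w n) \<and> w \<longlonglongrightarrow> 0 \<and> summable (\<lambda>n. a n / w n)"
proof -
  \<comment> \<open>The geometric term keeps the tails, and hence \<open>w\<close>, positive even
    where \<open>a\<close> vanishes.\<close>
  define b where "b n = a n + (1 / 2) ^ n" for n
  have b: "summable b" "\<And>n. 0 < b n"
    unfolding b_def using assms by (auto intro!: summable_add summable_geometric add_nonneg_pos)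
  define t where "t n = (\<Sum>m. b (m + n))" for n
  have tpos: "0 < t n" for n
    unfolding t_def using b by (intro suminf_pos summable_ignore_initial_segment) auto
  have tS: "t n - t (Suc n) = b n" for n
    using suminf_split_head[of "\<lambda>m. b (m + n)"] b by (simp add: t_def summable_ignore_initial_segment)
  have t0: "t \<longlonglongrightarrow> 0"
    unfolding t_def using b(1) by (rule suminf_exist_split2)
  define w where "w n = sqrt (t n) + sqrt (t (Suc n))" for n
  have sq0: "(\<lambda>n. sqrt (t n)) \<longlonglongrightarrow> 0" using tendsto_real_sqrt[OF t0] by simp
  have w: "0 < w n" for n using tpos[of n] tpos[of "Suc n"] by (simp add: w_def add_pos_pos)
  have w0: "w \<longlonglongrightarrow> 0" unfolding w_def using tendsto_add[OF sq0 LIMSEQ_Suc[OF sq0]] by simp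
  have "b n = (sqrt (t n) - sqrt (t (Suc n))) * w n" for n
    using tpos[of n] tpos[of "Suc n"] tS[of n] by (simp add: w_def algebra_simps)
  then have "b n / w n = sqrt (t n) - sqrt (t (Suc n))" for n using w[of n] by simp
  then have "summable (\<lambda>n. b n / w n)" using telescope_sums'[OF sq0] by (simp add: sums_iff)
  then have "summable (\<lambda>n. a n / w n)"
    by (rule summable_comparison_test'[where N = 0])
      (use w assms in \<open>auto simp: b_def less_imp_le intro!: divide_right_mono\<close>)
  with w w0 show ?thesis by blast
qed

text \<open>The trace of a finite rank operator can be read off from any nuclear representation. For
  \<open>R o\<^sub>L U\<close> with \<open>R\<close> of finite rank this is an interchange with a
  finite sum. The approximation property supplies an \<open>R\<close> close to the identity on a
  compact set containing all vectors involved, so that both traces change by little.\<close>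

lemma nuclear_trace_finite_rank:
  fixes n :: nat
  assumes AP: "approximation_property TYPE('e::banach)"
    and rep: "nuclear_rep (U :: 'e \<Rightarrow>\<^sub>L 'e) \<phi> u"
    and U: "\<And>x. blinfun_apply U x = (\<Sum>j<n. blinfun_apply (\<psi> j) x *\<^sub>R v j)"
  shows "(\<Sum>j<n. blinfun_apply (\<psi> j) (v j)) = (\<Sum>k. blinfun_apply (\<phi> k) (u k))"
proof -
  have "summable (\<lambda>k. norm (\<phi> k) * norm (u k))" using rep by (simp add: nuclear_rep_def)
  then have "\<exists>w. (\<forall>k. 0 < w k) \<and> w \<longlonglongrightarrow> 0 \<and> summable (\<lambda>k. norm (\<phi> k) * norm (u k) / w k)"
    by (rule summable_divide_null_sequence) simp
  then obtain w where w: "\<And>k. 0 < w k" "w \<longlonglongrightarrow> 0" "summable (\<lambda>k. norm (\<phi> k) * norm (u k) / w k)"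
    by blast
  \<comment> \<open>The norms are redistributed within each term: the functionals become absolutely
    summable and the vectors a null sequence. If \<open>u k = 0\<close>, both new factors are 0 and
    the term is unchanged.\<close>
  define \<phi>' where "\<phi>' k = (norm (u k) / w k) *\<^sub>R \<phi> k" for k
  define u' where "u' k = (w k / norm (u k)) *\<^sub>R u k" for k
  have same: "blinfun_apply (\<phi>' k) x *\<^sub>R u' k = blinfun_apply (\<phi> k) x *\<^sub>R u k"
    "blinfun_apply (\<phi>' k) (u' k) = blinfun_apply (\<phi> k) (u k)" for k x
    using w(1)[of k] by (simp_all add: \<phi>'_def u'_def blinfun.scaleR_left blinfun.scaleR_right)
  have sm: "summable (\<lambda>k. norm (\<phi>' k))"
    using w(1,3) by (simp add: \<phi>'_def mult.commute less_imp_le)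
  have "norm (u' k) \<le> w k" for k using w(1)[of k] by (simp add: u'_def)
  then have "u' \<longlonglongrightarrow> 0" using w(2) by (intro Lim_null_comparison[of u' w]) auto
  \<comment> \<open>A null sequence together with its limit is compact; the finitely many
    \<open>v j\<close> are added so that one \<open>R\<close> serves both representations.\<close>
  then have K: "compact (insert 0 (range u') \<union> v ` {..<n})"
    using compactin_sequence_with_limit[of euclidean u' 0 "range u'"]
    by (intro compact_Un finite_imp_compact[of "v ` _"]) simp_all
  define D where "D = (\<Sum>k. norm (\<phi>' k)) + (\<Sum>j<n. norm (\<psi> j))"
  have D: "0 \<le> D" unfolding D_def by (intro add_nonneg_nonneg suminf_nonneg sm sum_nonneg) auto
  have "\<bar>(\<Sum>k. blinfun_apply (\<phi>' k) (u' k)) - (\<Sum>j<n. blinfun_apply (\<psi> j) (v j))\<bar> \<le> 0 + e" if "0 < e" for e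
  proof -
    \<comment> \<open>\<open>D\<close> may be 0, hence the division by \<open>D + 1\<close>.\<close>
    define \<epsilon> where "\<epsilon> = e / (D + 1)"
    have \<epsilon>: "0 < \<epsilon>" "\<epsilon> * D \<le> e" using that D by (auto simp: \<epsilon>_def field_simps)
    have "\<exists>R::'e \<Rightarrow>\<^sub>L 'e. finite_rank R \<and>
        (\<forall>x\<in>insert 0 (range u') \<union> v ` {..<n}. norm (blinfun_apply R x - x) < \<epsilon>)"
      using AP[unfolded approximation_property_def, rule_format, OF \<epsilon>(1) K] .
    then obtain R :: "'e \<Rightarrow>\<^sub>L 'e" where R: "finite_rank R"
      and approx: "\<And>x. x \<in> insert 0 (range u') \<union> v ` {..<n} \<Longrightarrow> norm (blinfun_apply R x - x) < \<epsilon>"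
      by blast
    obtain B s where B: "finite B"
      and Rs: "\<And>x. blinfun_apply R x = (\<Sum>b\<in>B. blinfun_apply (s b) x *\<^sub>R b)"
      by (rule finite_rank_decomposition[OF R], rule that)
    \<comment> \<open>The sum over \<open>b\<close> of \<open>s b\<close> evaluated at
      \<open>U b\<close> is the trace of \<open>R o\<^sub>L U\<close>. Expanding \<open>U\<close> by
      the nuclear representation or by the finite sum computes it in two ways.\<close>
    have "(\<lambda>k. blinfun_apply (\<phi>' k) b *\<^sub>R u' k) sums blinfun_apply U b" for b
      using rep by (simp add: nuclear_rep_def rank_one_series_def same)
    then have "(\<lambda>k. blinfun_apply (s b) (blinfun_apply (\<phi>' k) b *\<^sub>R u' k)) sums blinfun_apply (s b) (blinfun_apply U b)" for b
      by (rule bounded_linear.sums[OF blinfun.bounded_linear_right])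
    then have "(\<lambda>k. \<Sum>b\<in>B. blinfun_apply (s b) (blinfun_apply (\<phi>' k) b *\<^sub>R u' k)) sums
        (\<Sum>b\<in>B. blinfun_apply (s b) (blinfun_apply U b))"
      by (intro sums_sum)
    moreover have "(\<Sum>b\<in>B. blinfun_apply (s b) (blinfun_apply (\<phi>' k) b *\<^sub>R u' k)) =
        blinfun_apply (\<phi>' k) (blinfun_apply R (u' k))" for k
      by (simp add: Rs blinfun.sum_right blinfun.scaleR_right mult.commute)
    moreover have "(\<Sum>b\<in>B. blinfun_apply (s b) (blinfun_apply U b)) = (\<Sum>j<n. blinfun_apply (\<psi> j) (blinfun_apply R (v j)))"
      unfolding U Rs blinfun.sum_right blinfun.scaleR_right
      by (subst sum.swap) (simp add: mult.commute)
    ultimately have tr: "(\<lambda>k. blinfun_apply (\<phi>' k) (blinfun_apply R (u' k))) sums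
        (\<Sum>j<n. blinfun_apply (\<psi> j) (blinfun_apply R (v j)))" by simp
    have est: "\<bar>blinfun_apply \<xi> (blinfun_apply R x) - blinfun_apply \<xi> x\<bar> \<le> \<epsilon> * norm \<xi>"
      if "x \<in> insert 0 (range u') \<union> v ` {..<n}" for \<xi> :: "'e \<Rightarrow>\<^sub>L real" and x
    proof -
      have "\<bar>blinfun_apply \<xi> (blinfun_apply R x) - blinfun_apply \<xi> x\<bar> \<le> norm \<xi> * norm (blinfun_apply R x - x)"
        using norm_blinfun[of \<xi> "blinfun_apply R x - x"] by (simp add: blinfun.diff_right)
      also have "\<dots> \<le> norm \<xi> * \<epsilon>" using approx[OF that] by (intro mult_left_mono) auto
      finally show ?thesis by (simp add: mult.commute)
    qed
    have "summable (\<lambda>k. blinfun_apply (\<phi>' k) (u' k))"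
    proof (rule summable_comparison_test'[of _ 0])
      show "summable (\<lambda>k. norm (\<phi> k) * norm (u k))" using rep by (simp add: nuclear_rep_def)
      show "norm (blinfun_apply (\<phi>' k) (u' k)) \<le> norm (\<phi> k) * norm (u k)" for k
        unfolding same by (rule norm_blinfun)
    qed
    then have "(\<lambda>k. blinfun_apply (\<phi>' k) (blinfun_apply R (u' k)) - blinfun_apply (\<phi>' k) (u' k)) sums
        ((\<Sum>j<n. blinfun_apply (\<psi> j) (blinfun_apply R (v j))) - (\<Sum>k. blinfun_apply (\<phi>' k) (u' k)))"
      by (intro sums_diff tr summable_sums)
    then have "\<bar>(\<Sum>j<n. blinfun_apply (\<psi> j) (blinfun_apply R (v j))) - (\<Sum>k. blinfun_apply (\<phi>' k) (u' k))\<bar>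
        = norm (\<Sum>k. blinfun_apply (\<phi>' k) (blinfun_apply R (u' k)) - blinfun_apply (\<phi>' k) (u' k))"
      by (simp add: sums_iff)
    also have "\<dots> \<le> (\<Sum>k. \<epsilon> * norm (\<phi>' k))"
      by (intro norm_suminf_le summable_mult sm) (simp add: est)
    also have "\<dots> = \<epsilon> * (\<Sum>k. norm (\<phi>' k))" using sm by (rule suminf_mult)
    finally have 1: "\<bar>(\<Sum>j<n. blinfun_apply (\<psi> j) (blinfun_apply R (v j))) - (\<Sum>k. blinfun_apply (\<phi>' k) (u' k))\<bar>
        \<le> \<epsilon> * (\<Sum>k. norm (\<phi>' k))" .
    have "\<bar>(\<Sum>j<n. blinfun_apply (\<psi> j) (blinfun_apply R (v j))) - (\<Sum>j<n. blinfun_apply (\<psi> j) (v j))\<bar>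
        \<le> (\<Sum>j<n. \<bar>blinfun_apply (\<psi> j) (blinfun_apply R (v j)) - blinfun_apply (\<psi> j) (v j)\<bar>)"
      unfolding sum_subtractf[symmetric] by (rule sum_abs)
    also have "\<dots> \<le> (\<Sum>j<n. \<epsilon> * norm (\<psi> j))" by (intro sum_mono est) auto
    also have "\<dots> = \<epsilon> * (\<Sum>j<n. norm (\<psi> j))" by (simp add: sum_distrib_left)
    finally have 2: "\<bar>(\<Sum>j<n. blinfun_apply (\<psi> j) (blinfun_apply R (v j))) - (\<Sum>j<n. blinfun_apply (\<psi> j) (v j))\<bar>
        \<le> \<epsilon> * (\<Sum>j<n. norm (\<psi> j))" .
    show ?thesis using 1 2 \<epsilon>(2) unfolding D_def distrib_left by linarith
  qed
  then have "\<bar>(\<Sum>k. blinfun_apply (\<phi>' k) (u' k)) - (\<Sum>j<n. blinfun_apply (\<psi> j) (v j))\<bar> \<le> 0"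
    by (rule field_le_epsilon)
  then show ?thesis by (simp add: same)
qed

lemma trace_le_nuclear_norm:
  fixes n :: nat
  assumes AP: "approximation_property TYPE('e::banach)" and "(U :: 'e \<Rightarrow>\<^sub>L 'e) \<in> nuclear"
    and U: "\<And>x. blinfun_apply U x = (\<Sum>j<n. blinfun_apply (\<psi> j) x *\<^sub>R v j)"
  shows "\<bar>\<Sum>j<n. blinfun_apply (\<psi> j) (v j)\<bar> \<le> nuclear_norm U"
  using assms(2)
proof (rule nuclear_norm_greatest)
  fix \<phi> :: "nat \<Rightarrow> 'e \<Rightarrow>\<^sub>L real" and u assume rep: "nuclear_rep U \<phi> u"
  have "norm (\<Sum>k. blinfun_apply (\<phi> k) (u k)) \<le> (\<Sum>k. norm (\<phi> k) * norm (u k))"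
    using rep by (intro norm_suminf_le norm_blinfun) (simp add: nuclear_rep_def)
  then show "\<bar>\<Sum>j<n. blinfun_apply (\<psi> j) (v j)\<bar> \<le> (\<Sum>k. norm (\<phi> k) * norm (u k))"
    using nuclear_trace_finite_rank[OF AP rep U] by simp
qed

subsection \<open>Weakly summable sequences and majorizing operators\<close>

lemma fin_seq_apply: "blinfun_apply f (fin_seq N a n) = fin_seq N (\<lambda>j. blinfun_apply f (a j)) n"
  by (simp add: fin_seq_def)

text \<open>Membership in \<open>lpw\<close> asks for summability at each functional separately.
  Uniform boundedness on the dual, which is complete, yields a bound on a whole ball, and thereby a
  bounded set for the supremum in \<open>lpw_norm\<close>.\<close>

lemma lpw_uniformly_bounded:
  fixes u :: "nat \<Rightarrow> 'a::real_normed_vector"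
  assumes s: "1 \<le> s" and u: "u \<in> lpw s"
  obtains r D where "0 < r" "\<And>\<phi> :: 'a \<Rightarrow>\<^sub>L real. norm \<phi> \<le> r \<Longrightarrow> p_norm s (\<lambda>n. blinfun_apply \<phi> (u n)) \<le> D"
  using s
proof (cases rule: exponent_cases)
  case top
  define q where "q n \<phi> = \<bar>blinfun_apply \<phi> (u n)\<bar>" for n and \<phi> :: "'a \<Rightarrow>\<^sub>L real"
  have cont: "continuous_on UNIV (q n)" for n
    unfolding q_def by (intro continuous_intros)
  have diff: "q n (\<phi> - \<psi>) \<le> 1 * (q n \<phi> + q n \<psi>)" for n \<phi> \<psi>
    by (simp add: q_def blinfun.diff_left)
  have bdd: "\<exists>M. \<forall>n. q n \<phi> \<le> M" for \<phi>
    using u top by (auto simp: lpw_def p_summable_def q_def bdd_above_def)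
  obtain r M where r: "0 < r" "\<And>n \<phi>. norm \<phi> \<le> r \<Longrightarrow> q n \<phi> \<le> M"
    by (rule uniform_boundedness[OF cont diff _ bdd], simp, rule that)
  show thesis
  proof (rule that[OF r(1)])
    fix \<phi> :: "'a \<Rightarrow>\<^sub>L real" assume "norm \<phi> \<le> r"
    then show "p_norm s (\<lambda>n. blinfun_apply \<phi> (u n)) \<le> M"
      using r(2) top by (auto simp: p_norm_def q_def intro!: cSUP_least)
  qed
next
  case (real P)
  define q where "q N \<phi> = (\<Sum>n<N. \<bar>blinfun_apply \<phi> (u n)\<bar> powr P)" for N and \<phi> :: "'a \<Rightarrow>\<^sub>L real"
  have cont: "continuous_on UNIV (q N)" for N
    unfolding q_def using real by (intro continuous_intros continuous_on_powr') auto
  have diff: "q N (\<phi> - \<psi>) \<le> 2 powr P * (q N \<phi> + q N \<psi>)" for N \<phi> \<psi>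
  proof -
    \<comment> \<open>The constant comes from bounding \<open>\<bar>a - b\<bar>\<close> by twice the
      larger of \<open>\<bar>a\<bar>\<close> and \<open>\<bar>b\<bar>\<close>, and the power of that
      maximum by the sum of both powers.\<close>
    have "\<bar>a - b\<bar> powr P \<le> 2 powr P * (\<bar>a\<bar> powr P + \<bar>b\<bar> powr P)" for a b :: real
    proof -
      have "\<bar>a - b\<bar> powr P \<le> (2 * max \<bar>a\<bar> \<bar>b\<bar>) powr P" using real by (intro powr_mono2) auto
      also have "\<dots> = 2 powr P * max \<bar>a\<bar> \<bar>b\<bar> powr P" by (simp add: powr_mult)
      also have "\<dots> \<le> 2 powr P * (\<bar>a\<bar> powr P + \<bar>b\<bar> powr P)"
        by (intro mult_left_mono) (auto simp: max_def)
      finally show ?thesis .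
    qed
    then show ?thesis
      unfolding q_def blinfun.diff_left sum.distrib[symmetric] sum_distrib_left by (intro sum_mono)
  qed
  have bdd: "\<exists>M. \<forall>N. q N \<phi> \<le> M" for \<phi>
  proof -
    have "summable (\<lambda>n. \<bar>blinfun_apply \<phi> (u n)\<bar> powr P)"
      using u real by (simp add: lpw_def p_summable_def)
    then show ?thesis unfolding q_def by (blast intro: sum_le_suminf[OF _ finite_lessThan] powr_ge_zero)
  qed
  obtain r M where r: "0 < r" "\<And>N \<phi>. norm \<phi> \<le> r \<Longrightarrow> q N \<phi> \<le> M"
    by (rule uniform_boundedness[OF cont diff _ bdd], simp, rule that)
  show thesis
  proof (rule that[OF r(1)])
    fix \<phi> :: "'a \<Rightarrow>\<^sub>L real" assume \<phi>: "norm \<phi> \<le> r"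
    have "p_norm s (fin_seq N (\<lambda>n. blinfun_apply \<phi> (u n))) \<le> M powr (1 / P)" for N
      using r(2)[OF \<phi>, of N] real by (auto simp: p_norm_fin_seq q_def intro!: powr_mono2 sum_nonneg)
    then show "p_norm s (\<lambda>n. blinfun_apply \<phi> (u n)) \<le> M powr (1 / P)"
      by (rule p_norm_limit(2)[OF s])
  qed
qed

lemma lpw_bdd_above:
  fixes u :: "nat \<Rightarrow> 'a::real_normed_vector"
  assumes s: "1 \<le> s" and u: "u \<in> lpw s"
  shows "bdd_above ((\<lambda>\<phi>. p_norm s (\<lambda>n. blinfun_apply \<phi> (u n))) ` {\<phi> :: 'a \<Rightarrow>\<^sub>L real. norm \<phi> \<le> 1})"
proof -
  obtain r D where r: "0 < r"
    and D: "\<And>\<phi> :: 'a \<Rightarrow>\<^sub>L real. norm \<phi> \<le> r \<Longrightarrow> p_norm s (\<lambda>n. blinfun_apply \<phi> (u n)) \<le> D"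
    by (rule lpw_uniformly_bounded[OF s u], rule that)
  have "p_norm s (\<lambda>n. blinfun_apply \<phi> (u n)) \<le> D / r" if "norm \<phi> \<le> 1" for \<phi> :: "'a \<Rightarrow>\<^sub>L real"
  proof -
    have "p_norm s (\<lambda>n. r * blinfun_apply \<phi> (u n)) = \<bar>r\<bar> * p_norm s (\<lambda>n. blinfun_apply \<phi> (u n))"
      using u by (intro p_norm_scale s) (simp add: lpw_def)
    moreover have "p_norm s (\<lambda>n. r * blinfun_apply \<phi> (u n)) \<le> D"
      using D[of "r *\<^sub>R \<phi>"] that r by (simp add: blinfun.scaleR_left)
    ultimately show ?thesis using r by (simp add: field_simps)
  qed
  then show ?thesis by (auto intro!: bdd_aboveI[of _ "D / r"])
qed

lemma lpw_norm_upper: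
  fixes u :: "nat \<Rightarrow> 'a::real_normed_vector"
  assumes s: "1 \<le> s" and u: "u \<in> lpw s"
  shows "p_norm s (\<lambda>n. blinfun_apply \<phi> (u n)) \<le> norm \<phi> * lpw_norm s u"
proof (cases "\<phi> = 0")
  case False
  have "p_norm s (\<lambda>n. blinfun_apply \<phi> (u n)) / norm \<phi> = \<bar>1 / norm \<phi>\<bar> * p_norm s (\<lambda>n. blinfun_apply \<phi> (u n))"
    by simp
  also have "\<dots> = p_norm s (\<lambda>n. (1 / norm \<phi>) * blinfun_apply \<phi> (u n))"
    using u by (intro p_norm_scale[symmetric] s) (simp add: lpw_def)
  also have "\<dots> = p_norm s (\<lambda>n. blinfun_apply ((1 / norm \<phi>) *\<^sub>R \<phi>) (u n))"
    by (simp add: blinfun.scaleR_left)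
  also have "\<dots> \<le> lpw_norm s u"
    unfolding lpw_norm_def by (rule cSUP_upper[OF _ lpw_bdd_above[OF assms]]) (simp add: False)
  finally show ?thesis using False by (simp add: field_simps)
qed simp

lemma lpw_norm_nonneg:
  assumes "1 \<le> s" "u \<in> lpw s"
  shows "0 \<le> lpw_norm s u"
  unfolding lpw_norm_def by (rule cSUP_upper2[OF lpw_bdd_above[OF assms], of 0]) simp_all

lemma fin_seq_in_lpw: "fin_seq N u \<in> lpw s"
  by (simp add: lpw_def fin_seq_apply)

lemma lpw_norm_fin_seq_le:
  fixes u :: "nat \<Rightarrow> 'a::real_normed_vector"
  assumes s: "1 \<le> s" and u: "u \<in> lpw s"
  shows "lpw_norm s (fin_seq N u) \<le> lpw_norm s u"
  unfolding lpw_norm_def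
proof (rule cSUP_mono[OF _ lpw_bdd_above[OF s u]])
  fix \<phi> :: "'a \<Rightarrow>\<^sub>L real" assume \<phi>: "\<phi> \<in> {\<phi>. norm \<phi> \<le> 1}"
  have "p_norm s (\<lambda>n. blinfun_apply \<phi> (fin_seq N u n)) \<le> p_norm s (\<lambda>n. blinfun_apply \<phi> (u n))"
    unfolding fin_seq_apply using u by (intro p_norm_fin_seq_le) (simp add: lpw_def)
  with \<phi> show "\<exists>\<psi>\<in>{\<phi>. norm \<phi> \<le> 1}. p_norm s (\<lambda>n. blinfun_apply \<phi> (fin_seq N u n))
      \<le> p_norm s (\<lambda>n. blinfun_apply \<psi> (u n))" by blast
qed (auto intro: exI[of _ 0])

lemma lpw_norm_scale_le:
  fixes u :: "nat \<Rightarrow> 'a::real_normed_vector"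
  assumes s: "1 \<le> s" and u: "u \<in> lpw s"
  shows "lpw_norm s (\<lambda>n. c *\<^sub>R u n) \<le> \<bar>c\<bar> * lpw_norm s u"
  unfolding lpw_norm_def[of s "\<lambda>n. c *\<^sub>R u n"]
proof (rule cSUP_least)
  fix \<phi> :: "'a \<Rightarrow>\<^sub>L real" assume "\<phi> \<in> {\<phi>. norm \<phi> \<le> 1}"
  then have "norm \<phi> * lpw_norm s u \<le> 1 * lpw_norm s u"
    by (intro mult_right_mono lpw_norm_nonneg s u) simp
  then have le: "p_norm s (\<lambda>n. blinfun_apply \<phi> (u n)) \<le> lpw_norm s u"
    using lpw_norm_upper[OF s u, of \<phi>] by simp
  have "p_norm s (\<lambda>n. c * blinfun_apply \<phi> (u n)) = \<bar>c\<bar> * p_norm s (\<lambda>n. blinfun_apply \<phi> (u n))"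
    using u by (intro p_norm_scale s) (simp add: lpw_def)
  also have "\<dots> \<le> \<bar>c\<bar> * lpw_norm s u" using le by (rule mult_left_mono) simp
  finally show "p_norm s (\<lambda>n. blinfun_apply \<phi> (c *\<^sub>R u n)) \<le> \<bar>c\<bar> * lpw_norm s u"
    by (simp add: blinfun.scaleR_right)
qed (auto intro: exI[of _ 0])

text \<open>For a sequence in a dual space the weak norm tests against the bidual. Evaluation at
  \<open>x\<close> is one such test, of norm at most \<open>norm x\<close>.\<close>

lemma lpw_evaluation:
  fixes \<phi> :: "nat \<Rightarrow> 'a::real_normed_vector \<Rightarrow>\<^sub>L real"
  assumes s: "1 \<le> s" and \<phi>: "\<phi> \<in> lpw s"
  shows "p_summable s (\<lambda>j. blinfun_apply (\<phi> j) x)"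
    and "p_norm s (\<lambda>j. blinfun_apply (\<phi> j) x) \<le> norm x * lpw_norm s \<phi>"
proof -
  define \<Phi> where "\<Phi> = Blinfun (\<lambda>\<psi> :: 'a \<Rightarrow>\<^sub>L real. blinfun_apply \<psi> x)"
  have \<Phi>: "blinfun_apply \<Phi> \<psi> = blinfun_apply \<psi> x" for \<psi>
    unfolding \<Phi>_def by (simp add: bounded_linear_Blinfun_apply blinfun.bounded_linear_left)
  have "norm \<Phi> \<le> norm x"
  proof (rule norm_blinfun_bound)
    show "norm (blinfun_apply \<Phi> \<psi>) \<le> norm x * norm \<psi>" for \<psi>
      using norm_blinfun[of \<psi> x] by (simp only: \<Phi> mult.commute)
  qed simp
  then have "norm \<Phi> * lpw_norm s \<phi> \<le> norm x * lpw_norm s \<phi>"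
    by (intro mult_right_mono lpw_norm_nonneg assms)
  then show "p_norm s (\<lambda>j. blinfun_apply (\<phi> j) x) \<le> norm x * lpw_norm s \<phi>"
    using lpw_norm_upper[OF assms, of \<Phi>] by (simp add: \<Phi>)
  have "p_summable s (\<lambda>j. blinfun_apply \<Phi> (\<phi> j))" using \<phi> by (simp add: lpw_def)
  then show "p_summable s (\<lambda>j. blinfun_apply (\<phi> j) x)" by (simp add: \<Phi>)
qed

section \<open>Operators given by a weakly and a strongly summable sequence\<close>

lemma lp_norm_nonneg: "u \<in> lp p \<Longrightarrow> 0 \<le> lp_norm p u"
  unfolding lp_def lp_norm_def by (simp add: p_norm_nonneg)

lemma
  fixes \<phi> :: "nat \<Rightarrow> 'a::real_normed_vector \<Rightarrow>\<^sub>L real" and u :: "nat \<Rightarrow> 'b::banach"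
  assumes p: "1 \<le> p" and \<phi>: "\<phi> \<in> lpw (conj_exp p)" and u: "u \<in> lp p"
  shows summable_rank_one: "summable (\<lambda>j. norm (blinfun_apply (\<phi> j) x *\<^sub>R u j))"
    and suminf_rank_one_le:
      "(\<Sum>j. norm (blinfun_apply (\<phi> j) x *\<^sub>R u j)) \<le> norm x * (lpw_norm (conj_exp p) \<phi> * lp_norm p u)"
proof -
  note ev = lpw_evaluation[OF conj_exp_ge_1[OF p] \<phi>, of x]
  have u': "p_summable p (\<lambda>j. norm (u j))" using u by (simp add: lp_def)
  from Hoelder[OF p ev(1) u']
  show "summable (\<lambda>j. norm (blinfun_apply (\<phi> j) x *\<^sub>R u j))" by (simp add: abs_mult)
  have "(\<Sum>j. norm (blinfun_apply (\<phi> j) x *\<^sub>R u j))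
      \<le> p_norm (conj_exp p) (\<lambda>j. blinfun_apply (\<phi> j) x) * lp_norm p u"
    using Hoelder(2)[OF p ev(1) u'] by (simp add: abs_mult lp_norm_def)
  also have "\<dots> \<le> norm x * lpw_norm (conj_exp p) \<phi> * lp_norm p u"
    by (intro mult_right_mono ev lp_norm_nonneg u)
  finally show "(\<Sum>j. norm (blinfun_apply (\<phi> j) x *\<^sub>R u j)) \<le> norm x * (lpw_norm (conj_exp p) \<phi> * lp_norm p u)"
    by (simp add: mult.assoc)
qed

text \<open>Hoelder's inequality makes the series converge absolutely at each \<open>x\<close>, with
  a bound linear in \<open>norm x\<close>, so its pointwise sum is a bounded operator for every
  exponent, \<open>p = \<infinity>\<close> included.\<close>

lemma rank_one_series_exists:
  fixes \<phi> :: "nat \<Rightarrow> 'a::real_normed_vector \<Rightarrow>\<^sub>L real" and u :: "nat \<Rightarrow> 'b::banach"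
  assumes p: "1 \<le> p" and \<phi>: "\<phi> \<in> lpw (conj_exp p)" and u: "u \<in> lp p"
  shows "\<exists>T. rank_one_series \<phi> u T"
proof -
  define f where "f x = (\<Sum>j. blinfun_apply (\<phi> j) x *\<^sub>R u j)" for x
  have sm: "summable (\<lambda>j. blinfun_apply (\<phi> j) x *\<^sub>R u j)" for x
    by (rule summable_norm_cancel[OF summable_rank_one[OF assms]])
  have "bounded_linear f"
  proof (rule bounded_linear_intro)
    fix x y :: 'a and c :: real
    show "f (x + y) = f x + f y"
      unfolding f_def suminf_add[OF sm sm] by (simp add: blinfun.add_right scaleR_add_left)
    show "f (c *\<^sub>R x) = c *\<^sub>R f x"
      unfolding f_def suminf_scaleR_right[OF sm] by (simp add: blinfun.scaleR_right)
    show "norm (f x) \<le> norm x * (lpw_norm (conj_exp p) \<phi> * lp_norm p u)"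
      unfolding f_def
      using summable_norm[OF summable_rank_one[OF assms]] suminf_rank_one_le[OF assms] by (rule order_trans)
  qed
  then have "blinfun_apply (Blinfun f) x = f x" for x by (simp add: bounded_linear_Blinfun_apply)
  then have "rank_one_series \<phi> u (Blinfun f)"
    by (simp add: rank_one_series_def f_def summable_sums sm)
  then show ?thesis ..
qed

lemma rank_one_series_scale:
  assumes "rank_one_series \<phi> u T"
  shows "rank_one_series \<phi> (\<lambda>j. c *\<^sub>R u j) (c *\<^sub>R T)"
proof -
  have "(\<lambda>j. c *\<^sub>R (blinfun_apply (\<phi> j) x *\<^sub>R u j)) sums (c *\<^sub>R blinfun_apply T x)" for x
    using assms by (intro sums_scaleR_right) (simp add: rank_one_series_def)
  then show ?thesis
    by (simp add: rank_one_series_def scaleR_blinfun.rep_eq mult.commute[of _ c])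
qed

lemma rank_one_series_unique:
  assumes "rank_one_series \<phi> u T" "rank_one_series \<phi> u T'"
  shows "T = T'"
proof (rule blinfun_eqI)
  fix x
  show "blinfun_apply T x = blinfun_apply T' x"
    using assms[unfolded rank_one_series_def, THEN spec, of x] by (rule sums_unique2)
qed

lemma lp_mult:
  assumes "u \<in> lp p" "\<And>j. \<bar>b j\<bar> \<le> M"
  shows "(\<lambda>j. b j *\<^sub>R u j) \<in> lp p"
proof -
  have "p_summable p (\<lambda>j. M * norm (u j))" using assms by (intro p_summable_scale) (simp add: lp_def)
  then have "p_summable p (\<lambda>j. norm (b j *\<^sub>R u j))"
  proof (rule p_summable_mono)
    have "0 \<le> M" using assms(2)[of 0] by linarith
    then show "\<bar>norm (b n *\<^sub>R u n)\<bar> \<le> \<bar>M * norm (u n)\<bar>" for n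
      using mult_right_mono[OF assms(2)[of n], of "norm (u n)"] by (simp add: abs_mult)
  qed
  then show ?thesis by (simp add: lp_def)
qed

lemma lp_norm_scale: "1 \<le> p \<Longrightarrow> u \<in> lp p \<Longrightarrow> lp_norm p (\<lambda>j. c *\<^sub>R u j) = \<bar>c\<bar> * lp_norm p u"
  using p_norm_scale[of p "\<lambda>j. norm (u j)" "\<bar>c\<bar>"] by (simp add: lp_def lp_norm_def)

lemma pos_nuclear_norm_le:
  assumes p: "1 \<le> p" and rep: "pos_nuclear_rep p T \<phi> u"
  shows "pos_nuclear_norm p T \<le> lpw_norm (conj_exp p) \<phi> * lp_norm p u"
  unfolding pos_nuclear_norm_def
proof (rule cInf_lower)
  show "bdd_below {lpw_norm (conj_exp p) \<phi> * lp_norm p u | \<phi> u. pos_nuclear_rep p T \<phi> u}"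
    by (rule bdd_belowI[of _ 0])
      (auto simp: pos_nuclear_rep_def intro!: mult_nonneg_nonneg lpw_norm_nonneg lp_norm_nonneg conj_exp_ge_1 p)
qed (use rep in blast)

section \<open>Composition with a majorizing operator\<close>

lemma norm_blinfun_approx:
  fixes \<psi> :: "'a::real_normed_vector \<Rightarrow>\<^sub>L real"
  assumes "0 \<le> t" "t < 1"
  shows "\<exists>v. norm v \<le> 1 \<and> t * norm \<psi> \<le> blinfun_apply \<psi> v"
proof (rule ccontr)
  assume "\<not> ?thesis"
  then have less: "blinfun_apply \<psi> v < t * norm \<psi>" if "norm v \<le> 1" for v
    using that by force
  have "norm \<psi> \<le> t * norm \<psi>"
  proof (rule norm_blinfun_bound)
    fix x
    show "norm (blinfun_apply \<psi> x) \<le> t * norm \<psi> * norm x"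
    proof (cases "x = 0")
      case False
      \<comment> \<open>Testing the normalized vector and its negative restores the absolute
        value.\<close>
      have "blinfun_apply \<psi> ((1 / norm x) *\<^sub>R x) < t * norm \<psi>" "blinfun_apply \<psi> ((- (1 / norm x)) *\<^sub>R x) < t * norm \<psi>"
        using False by (auto intro!: less)
      then have "\<bar>blinfun_apply \<psi> x\<bar> / norm x < t * norm \<psi>"
        by (simp add: blinfun.scaleR_right blinfun.minus_right abs_if)
      then show ?thesis using False by (simp add: field_simps)
    qed simp
  qed (use assms in simp)
  moreover have "norm \<psi> \<noteq> 0" using less[of 0] by auto
  ultimately show False using assms by (simp add: mult_le_cancel_right1)
qed

text \<open>The unit vectors \<open>v j\<close> attain the norms of the
  \<open>\<phi> j o\<^sub>L S\<close> only up to a factor \<open>t < 1\<close>. As \<open>t\<close>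
  is the same for all \<open>j\<close>, it leaves the norm by homogeneity; letting \<open>t\<close>
  tend to 1 and then \<open>N\<close> to infinity gives the claim.\<close>

lemma majorizing_strong_p_norm:
  fixes S :: "'e::banach \<Rightarrow>\<^sub>L 'x::banach_lattice"
  assumes s: "1 \<le> s" and maj: "majorizing_const s S C" and C: "0 \<le> C"
    and \<phi>: "\<phi> \<in> lpw s" "\<And>j. \<phi> j \<in> dual_cone"
  shows "p_summable s (\<lambda>j. norm (\<phi> j o\<^sub>L S))" "p_norm s (\<lambda>j. norm (\<phi> j o\<^sub>L S)) \<le> C * lpw_norm s \<phi>"
proof -
  have le: "t * p_norm s (fin_seq N (\<lambda>j. norm (\<phi> j o\<^sub>L S))) \<le> C * lpw_norm s \<phi>" if t: "0 < t" "t < 1" for N t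
  proof -
    have "\<forall>j. \<exists>v. norm v \<le> 1 \<and> t * norm (\<phi> j o\<^sub>L S) \<le> blinfun_apply (\<phi> j o\<^sub>L S) v"
      using t by (intro allI norm_blinfun_approx) auto
    from choice[OF this] obtain v where v: "\<And>j. norm (v j) \<le> 1"
      "\<And>j. t * norm (\<phi> j o\<^sub>L S) \<le> blinfun_apply (\<phi> j) (blinfun_apply S (v j))" by auto
    have "t * p_norm s (fin_seq N (\<lambda>j. norm (\<phi> j o\<^sub>L S))) = p_norm s (\<lambda>j. t * fin_seq N (\<lambda>j. norm (\<phi> j o\<^sub>L S)) j)"
      using t by (simp add: p_norm_scale s)
    also have "\<dots> \<le> p_norm s (fin_seq N (\<lambda>j. blinfun_apply (\<phi> j) (blinfun_apply S (v j))))"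
    proof (rule p_norm_mono)
      show "\<bar>t * fin_seq N (\<lambda>j. norm (\<phi> j o\<^sub>L S)) n\<bar>
          \<le> \<bar>fin_seq N (\<lambda>j. blinfun_apply (\<phi> j) (blinfun_apply S (v j))) n\<bar>" for n
        using order_trans[OF v(2)[of n] abs_ge_self] t by (simp add: fin_seq_def abs_mult)
    qed simp
    also have "\<dots> \<le> C * lpw_norm s (fin_seq N \<phi>)"
      using maj v(1) \<phi>(2) unfolding majorizing_const_def by blast
    also have "\<dots> \<le> C * lpw_norm s \<phi>"
      using C by (intro mult_left_mono lpw_norm_fin_seq_le s \<phi>)
    finally show ?thesis .
  qed
  have "p_norm s (fin_seq N (\<lambda>j. norm (\<phi> j o\<^sub>L S))) \<le> C * lpw_norm s \<phi>" for N
    by (rule field_le_mult_one_interval) (use le in auto)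
  from p_norm_limit[OF s this]
  show "p_summable s (\<lambda>j. norm (\<phi> j o\<^sub>L S))" "p_norm s (\<lambda>j. norm (\<phi> j o\<^sub>L S)) \<le> C * lpw_norm s \<phi>" .
qed

lemma majorizing_nuclear_rep:
  fixes S :: "'e::banach \<Rightarrow>\<^sub>L 'x::banach_lattice" and T :: "'x \<Rightarrow>\<^sub>L 'e"
  assumes p: "1 \<le> p" and maj: "majorizing_const (conj_exp p) S C" and C: "0 \<le> C"
    and rep: "pos_nuclear_rep p T \<phi> u"
  shows "nuclear_rep (T o\<^sub>L S) (\<lambda>j. \<phi> j o\<^sub>L S) u"
    and "(\<Sum>j. norm (\<phi> j o\<^sub>L S) * norm (u j)) \<le> C * (lpw_norm (conj_exp p) \<phi> * lp_norm p u)"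
proof -
  have \<phi>: "\<phi> \<in> lpw (conj_exp p)" "\<And>j. \<phi> j \<in> dual_cone" and u: "u \<in> lp p" and T: "rank_one_series \<phi> u T"
    using rep by (auto simp: pos_nuclear_rep_def)
  note st = majorizing_strong_p_norm[OF conj_exp_ge_1[OF p] maj C \<phi>]
  have u': "p_summable p (\<lambda>j. norm (u j))" using u by (simp add: lp_def)
  note H = Hoelder[OF p st(1) u', unfolded abs_mult abs_norm_cancel]
  show "nuclear_rep (T o\<^sub>L S) (\<lambda>j. \<phi> j o\<^sub>L S) u"
    using H(1) T by (simp add: nuclear_rep_def rank_one_series_def)
  have "(\<Sum>j. norm (\<phi> j o\<^sub>L S) * norm (u j)) \<le> p_norm (conj_exp p) (\<lambda>j. norm (\<phi> j o\<^sub>L S)) * lp_norm p u"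
    using H(2) by (simp add: lp_norm_def)
  also have "\<dots> \<le> C * lpw_norm (conj_exp p) \<phi> * lp_norm p u"
    by (intro mult_right_mono st lp_norm_nonneg u)
  finally show "(\<Sum>j. norm (\<phi> j o\<^sub>L S) * norm (u j)) \<le> C * (lpw_norm (conj_exp p) \<phi> * lp_norm p u)"
    by (simp add: mult.assoc)
qed

lemma nuclear_norm_le_majorizing:
  fixes S :: "'e::banach \<Rightarrow>\<^sub>L 'x::banach_lattice" and T :: "'x \<Rightarrow>\<^sub>L 'e"
  assumes p: "1 \<le> p" and maj: "majorizing_const (conj_exp p) S C" and C: "0 < C"
    and T: "T \<in> pos_nuclear p"
  shows "nuclear_norm (T o\<^sub>L S) \<le> C * pos_nuclear_norm p T"
proof -
  have "nuclear_norm (T o\<^sub>L S) / C \<le> pos_nuclear_norm p T"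
    unfolding pos_nuclear_norm_def
  proof (rule cInf_greatest)
    fix y assume "y \<in> {lpw_norm (conj_exp p) \<phi> * lp_norm p u | \<phi> u. pos_nuclear_rep p T \<phi> u}"
    then obtain \<phi> u where rep: "pos_nuclear_rep p T \<phi> u" and y: "y = lpw_norm (conj_exp p) \<phi> * lp_norm p u"
      by blast
    have "nuclear_norm (T o\<^sub>L S) \<le> C * y"
      using nuclear_norm_le[OF majorizing_nuclear_rep(1)[OF p maj _ rep]]
        majorizing_nuclear_rep(2)[OF p maj _ rep] C unfolding y by linarith
    then show "nuclear_norm (T o\<^sub>L S) / C \<le> y" using C by (simp add: field_simps)
  qed (use T in \<open>auto simp: pos_nuclear_def\<close>)
  then show ?thesis using C by (simp add: field_simps)
qed

subsection \<open>Boundedness of composition\<close>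

instance bcontfun :: (metric_space, banach) banach ..

text \<open>The multipliers \<open>b\<^sub>j\<close> are taken to be the values \<open>b(j)\<close> of bounded continuous functions on
  the reals, since the library proves completeness of this type only over metric domains and
  \<open>nat\<close> is not an instance; the closed graph theorem is replaced by Zabreiko's
  lemma for \<open>b \<mapsto> \<nu>(T\<^sub>b S)\<close>, where \<open>T\<^sub>b = \<Sum>\<^sub>j b(j) \<phi>\<^sub>j \<otimes> u\<^sub>j\<close>.\<close>

lemma bounded_trace_of_U_star:
  fixes S :: "'e::banach \<Rightarrow>\<^sub>L 'x::banach_lattice"
  assumes p: "1 \<le> p" and AP: "approximation_property TYPE('e)" and S: "S \<in> U_star p"
    and \<phi>: "\<phi> \<in> lpw (conj_exp p)" "\<And>j. \<phi> j \<in> dual_cone" and u: "u \<in> lp p"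
  shows "\<exists>M. \<forall>N b. (\<forall>j. \<bar>b j\<bar> \<le> 1) \<longrightarrow>
    \<bar>\<Sum>j<N. b j * blinfun_apply (\<phi> j) (blinfun_apply S (u j))\<bar> \<le> M"
proof -
  have lp: "(\<lambda>j. apply_bcontfun b (real j) *\<^sub>R u j) \<in> lp p" for b :: "real \<Rightarrow>\<^sub>C real"
    by (rule lp_mult[OF u, of _ "norm b"]) (use norm_bounded[of b] in simp)
  have "\<forall>b :: real \<Rightarrow>\<^sub>C real. \<exists>T. rank_one_series \<phi> (\<lambda>j. apply_bcontfun b (real j) *\<^sub>R u j) T"
    by (intro allI rank_one_series_exists[OF p \<phi>(1) lp])
  from choice[OF this] obtain T :: "(real \<Rightarrow>\<^sub>C real) \<Rightarrow> 'x \<Rightarrow>\<^sub>L 'e"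
    where T: "\<And>b. rank_one_series \<phi> (\<lambda>j. apply_bcontfun b (real j) *\<^sub>R u j) (T b)" by auto
  have nuc: "T b o\<^sub>L S \<in> nuclear" for b
  proof -
    have "T b \<in> pos_nuclear p"
      unfolding pos_nuclear_def pos_nuclear_rep_def using \<phi> lp T by blast
    then show ?thesis using S by (simp add: U_star_def)
  qed
  have T_sums: "(\<lambda>j. (blinfun_apply (\<phi> j) x * apply_bcontfun b (real j)) *\<^sub>R u j) sums blinfun_apply (T b) x" for b x
    using T[of b] by (simp add: rank_one_series_def)
  have T_scale: "T (c *\<^sub>R b) = c *\<^sub>R T b" for c b
    using rank_one_series_scale[OF T[of b], of c]
    by (intro rank_one_series_unique[OF T[of "c *\<^sub>R b"]]) (simp add: scaleR_bcontfun.rep_eq)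
  \<comment> \<open>Continuity in \<open>b\<close> at each fixed \<open>x\<close> turns a convergent
    series of multipliers into the pointwise convergent series of operators required by
    \<open>nuclear_norm_suminf\<close>.\<close>
  have lin: "bounded_linear (\<lambda>b. blinfun_apply (T b) x)" for x
  proof (rule bounded_linear_intro)
    fix b b' :: "real \<Rightarrow>\<^sub>C real" and c :: real
    show "blinfun_apply (T (b + b')) x = blinfun_apply (T b) x + blinfun_apply (T b') x"
      using sums_add[OF T_sums[of x b] T_sums[of x b']]
      by (intro sums_unique2[OF T_sums[of x "b + b'"]])
        (simp add: plus_bcontfun.rep_eq distrib_left scaleR_add_left)
    show "blinfun_apply (T (c *\<^sub>R b)) x = c *\<^sub>R blinfun_apply (T b) x"
      by (simp add: T_scale scaleR_blinfun.rep_eq)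
    have sm: "summable (\<lambda>j. norm b * norm (blinfun_apply (\<phi> j) x *\<^sub>R u j))"
      by (rule summable_mult[OF summable_rank_one[OF p \<phi>(1) u]])
    have "norm (blinfun_apply (T b) x) = norm (\<Sum>j. (blinfun_apply (\<phi> j) x * apply_bcontfun b (real j)) *\<^sub>R u j)"
      using T_sums[of x b] by (simp add: sums_iff)
    also have "\<dots> \<le> (\<Sum>j. norm b * norm (blinfun_apply (\<phi> j) x *\<^sub>R u j))"
    proof (rule norm_suminf_le[OF _ sm])
      fix j
      show "norm ((blinfun_apply (\<phi> j) x * apply_bcontfun b (real j)) *\<^sub>R u j) \<le> norm b * norm (blinfun_apply (\<phi> j) x *\<^sub>R u j)"
        using mult_right_mono[OF norm_bounded[of b "real j"], of "\<bar>blinfun_apply (\<phi> j) x\<bar> * norm (u j)"]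
        by (simp add: abs_mult mult_ac)
    qed
    also have "\<dots> = norm b * (\<Sum>j. norm (blinfun_apply (\<phi> j) x *\<^sub>R u j))"
      by (rule suminf_mult[OF summable_rank_one[OF p \<phi>(1) u]])
    finally show "norm (blinfun_apply (T b) x) \<le> norm b * (\<Sum>j. norm (blinfun_apply (\<phi> j) x *\<^sub>R u j))" .
  qed
  define q where "q b = nuclear_norm (T b o\<^sub>L S)" for b
  have "\<exists>M\<ge>0. \<forall>b. q b \<le> M * norm b"
  proof (rule Zabreiko, goal_cases)
    case (2 c b)
    have "T (c *\<^sub>R b) o\<^sub>L S = c *\<^sub>R (T b o\<^sub>L S)"
      by (rule blinfun_eqI) (simp add: T_scale scaleR_blinfun.rep_eq)
    then show ?case unfolding q_def using nuclear_norm_scale[OF nuc] by simp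
  next
    case (3 b)
    have "b sums (\<Sum>k. b k)" by (rule summable_sums[OF summable_norm_cancel]) fact
    from bounded_linear.sums[OF lin this]
    show ?case
      unfolding q_def using 3 by (intro nuclear_norm_suminf nuc) (simp_all add: q_def)
  qed (simp_all add: q_def nuclear_norm_nonneg nuc)
  then obtain M where M: "0 \<le> M" "\<And>b. q b \<le> M * norm b" by blast
  have "\<bar>\<Sum>j<N. b j * blinfun_apply (\<phi> j) (blinfun_apply S (u j))\<bar> \<le> M"
    if b: "\<forall>j. \<bar>b j\<bar> \<le> 1" for N and b :: "nat \<Rightarrow> real"
  proof -
    \<comment> \<open>The hat function centred at \<open>j\<close> vanishes at all other integers,
      so the sum interpolates \<open>b\<close> at the indices below \<open>N\<close> and is 0 at the
      remaining ones. Clipping to the interval from -1 to 1 bounds the norm by 1 and leaves the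
      interpolated values unchanged.\<close>
    define f where "f t = max (- 1) (min 1 (\<Sum>j<N. b j * max 0 (1 - \<bar>t - real j\<bar>)))" for t
    have "continuous_on UNIV f" unfolding f_def by (intro continuous_intros)
    moreover have f1: "norm (f t) \<le> 1" for t by (auto simp: f_def)
    ultimately have f: "f \<in> bcontfun" by (rule bcontfun_normI)
    define b' where "b' = Bcontfun f"
    have b': "apply_bcontfun b' (real i) = (if i < N then b i else 0)" for i
    proof -
      have "b j * max 0 (1 - \<bar>real i - real j\<bar>) = (if i = j then b j else 0)" for j by auto
      then have "(\<Sum>j<N. b j * max 0 (1 - \<bar>real i - real j\<bar>)) = (if i < N then b i else 0)"
        by simp
      then show ?thesis using b[rule_format, of i] f by (auto simp: b'_def Bcontfun_inverse f_def)
    qed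
    have "norm b' \<le> 1" by (rule norm_bound) (simp add: b'_def Bcontfun_inverse f f1 del: real_norm_def)
    have U: "blinfun_apply (T b' o\<^sub>L S) y = (\<Sum>j<N. blinfun_apply (\<phi> j o\<^sub>L S) y *\<^sub>R (b j *\<^sub>R u j))" for y
    proof -
      have "(\<lambda>j. (blinfun_apply (\<phi> j) (blinfun_apply S y) * apply_bcontfun b' (real j)) *\<^sub>R u j) sums
          (\<Sum>j<N. (blinfun_apply (\<phi> j) (blinfun_apply S y) * apply_bcontfun b' (real j)) *\<^sub>R u j)"
        by (rule sums_finite) (auto simp: b')
      from sums_unique2[OF this T_sums] show ?thesis by (simp add: b')
    qed
    have "\<bar>\<Sum>j<N. b j * blinfun_apply (\<phi> j) (blinfun_apply S (u j))\<bar>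
        = \<bar>\<Sum>j<N. blinfun_apply (\<phi> j o\<^sub>L S) (b j *\<^sub>R u j)\<bar>"
      by (simp add: blinfun.scaleR_right)
    also have "\<dots> \<le> nuclear_norm (T b' o\<^sub>L S)" by (rule trace_le_nuclear_norm[OF AP nuc U])
    also have "\<dots> \<le> M * norm b'" using M(2)[of b'] by (simp add: q_def)
    also have "\<dots> \<le> M" using M(1) \<open>norm b' \<le> 1\<close> by (simp add: mult_left_le)
    finally show ?thesis .
  qed
  then show ?thesis by blast
qed

text \<open>Rows of norm at most \<open>D\<close> are damped by \<open>(1 / 2) ^ k\<close> and
  strung together. This merges infinitely many representations into one, and is used for the
  functionals as well as for the vectors.\<close>

lemma p_summable_prod_decode:
  assumes s: "1 \<le> s" and f: "\<And>k. p_summable s (f k)" "\<And>k. p_norm s (f k) \<le> D"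
  shows "p_summable s (\<lambda>i. case prod_decode i of (k, j) \<Rightarrow> (1 / 2) ^ k * f k j)"
  using s
proof (cases rule: exponent_cases)
  case top
  have "\<bar>(1 / 2) ^ k * f k j\<bar> \<le> D" for k j
  proof -
    have "\<bar>(1 / 2) ^ k * f k j\<bar> \<le> 1 * \<bar>f k j\<bar>"
      unfolding abs_mult by (intro mult_right_mono) (auto simp: power_le_one)
    also have "\<dots> \<le> D" using abs_le_p_norm_top[of "f k" j] f[of k] top by simp
    finally show ?thesis .
  qed
  then show ?thesis using top by (auto simp: p_summable_def split: prod.split intro!: bdd_aboveI[of _ D])
next
  case (real P)
  define g where "g k j = ((1 / 2) ^ k) powr P * \<bar>f k j\<bar> powr P" for k :: nat and j
  have f1: "summable (\<lambda>j. \<bar>f k j\<bar> powr P)" for k using f(1)[of k] real by (simp add: p_summable_def)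
  have le: "(\<Sum>j. \<bar>f k j\<bar> powr P) \<le> D powr P" for k
  proof -
    have "(\<Sum>j. \<bar>f k j\<bar> powr P) = p_norm s (f k) powr P"
      using real f1[of k] by (simp add: p_norm_def powr_powr suminf_nonneg)
    also have "\<dots> \<le> D powr P"
      using real f(2)[of k] p_norm_nonneg[OF f(1)] by (intro powr_mono2) auto
    finally show ?thesis .
  qed
  have g1: "summable (\<lambda>j. norm (g k j))" for k
    unfolding g_def using f1[of k] by (simp add: summable_mult)
  have g2: "(\<Sum>j. norm (g k j)) \<le> (1 / 2) ^ k * D powr P" for k
  proof -
    \<comment> \<open>Because \<open>1 \<le> P\<close>, raising the damping factor to the power
      \<open>P\<close> only decreases it, and a geometric majorant remains.\<close>
    have "((1 / 2) ^ k) powr P \<le> ((1 / 2 :: real) ^ k) powr 1"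
      using real by (intro powr_mono') (auto simp: power_le_one)
    moreover have "(\<Sum>j. norm (g k j)) = ((1 / 2) ^ k) powr P * (\<Sum>j. \<bar>f k j\<bar> powr P)"
      unfolding g_def using suminf_mult[OF f1[of k]] by simp
    ultimately show ?thesis using le[of k] by (simp add: mult_mono suminf_nonneg f1)
  qed
  have "summable (\<lambda>k. \<Sum>j. norm (g k j))"
  proof (rule summable_comparison_test')
    show "summable (\<lambda>k. (1 / 2) ^ k * D powr P)" by (intro summable_mult2 summable_geometric) simp
    show "norm (\<Sum>j. norm (g k j)) \<le> (1 / 2) ^ k * D powr P" for k
      using g2[of k] suminf_nonneg[OF g1[of k]] by (simp only: real_norm_def abs_of_nonneg norm_ge_zero)
  qed
  from sums_prod_decode(1)[OF g1 this]
  have "summable (\<lambda>i. norm (case_prod g (prod_decode i)))" .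
  moreover have "norm (case_prod g (prod_decode i)) = \<bar>case prod_decode i of (k, j) \<Rightarrow> (1 / 2) ^ k * f k j\<bar> powr P" for i
    by (simp add: g_def abs_mult powr_mult split: prod.split)
  ultimately show ?thesis using real by (simp add: p_summable_def)
qed

lemma dual_cone_scale: "0 \<le> c \<Longrightarrow> \<phi> \<in> dual_cone \<Longrightarrow> c *\<^sub>R \<phi> \<in> dual_cone"
  by (simp add: dual_cone_def scaleR_blinfun.rep_eq)

lemma fin_seq_dual_cone: "(\<And>j. j < n \<Longrightarrow> \<phi> j \<in> dual_cone) \<Longrightarrow> fin_seq n \<phi> j \<in> dual_cone"
  by (simp add: fin_seq_def dual_cone_def)

text \<open>A family violating the inequality for \<open>C\<close> is normalized: the functionals
  are divided by (almost) their weak norm, and coefficients from \<open>Hoelder_attained\<close>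
  turn the large \<open>p_norm\<close> into a large trace.\<close>

lemma large_trace_of_not_majorizing:
  fixes S :: "'e::banach \<Rightarrow>\<^sub>L 'x::banach_lattice"
  assumes p: "1 \<le> p" and not: "\<not> majorizing_const (conj_exp p) S C"
  obtains n \<phi> u where "\<phi> \<in> lpw (conj_exp p)" "\<And>j. \<phi> j \<in> dual_cone" "lpw_norm (conj_exp p) \<phi> \<le> 1"
    "u \<in> lp p" "lp_norm p u \<le> 1" "C < (\<Sum>j<n. blinfun_apply (\<phi> j) (blinfun_apply S (u j)))"
proof -
  define r where "r = conj_exp p"
  have r: "1 \<le> r" unfolding r_def using p by (rule conj_exp_ge_1)
  from not obtain n v \<psi> where v: "\<And>j. j < n \<Longrightarrow> norm (v j) \<le> 1" and \<psi>: "\<And>j. j < n \<Longrightarrow> \<psi> j \<in> dual_cone"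
    and big: "C * lpw_norm r (fin_seq n \<psi>) < p_norm r (fin_seq n (\<lambda>j. blinfun_apply (\<psi> j) (blinfun_apply S (v j))))"
    unfolding majorizing_const_def r_def by (auto simp: not_le)
  define Y where "Y = p_norm r (fin_seq n (\<lambda>j. blinfun_apply (\<psi> j) (blinfun_apply S (v j))))"
  define A where "A = lpw_norm r (fin_seq n \<psi>)"
  have A: "0 \<le> A" unfolding A_def by (rule lpw_norm_nonneg[OF r fin_seq_in_lpw])
  \<comment> \<open>The weak norm \<open>A\<close> may be 0, so it is enlarged slightly to a divisor
    that keeps the strict inequality, whatever the sign of \<open>C\<close>.\<close>
  obtain A' where A': "A \<le> A'" "0 < A'" "C * A' < Y"
  proof -
    define D where "D = \<bar>C\<bar> + 1"
    define d where "d = (Y - C * A) / (2 * D)"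
    have D: "0 < D" by (simp add: D_def)
    have d: "0 < d" using big D by (simp add: d_def A_def Y_def)
    have "C * d \<le> D * d" using d by (intro mult_right_mono) (auto simp: D_def)
    also have "\<dots> = (Y - C * A) / 2" using D by (simp add: d_def)
    also have "\<dots> < Y - C * A" using big by (simp add: A_def Y_def)
    finally have "C * d < Y - C * A" .
    then show thesis using that[of "A + d"] A d by (simp add: distrib_left)
  qed
  obtain a where a: "p_norm p (fin_seq n a) \<le> 1"
    "(\<Sum>j<n. a j * blinfun_apply (\<psi> j) (blinfun_apply S (v j))) = Y"
    using Hoelder_attained[OF p, of n "\<lambda>j. blinfun_apply (\<psi> j) (blinfun_apply S (v j))"]
    unfolding Y_def r_def by blast
  define \<phi> where "\<phi> j = (1 / A') *\<^sub>R fin_seq n \<psi> j" for j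
  \<comment> \<open>The coefficients may be negative. They are attached to the vectors, so the
    functionals stay in \<open>dual_cone\<close>.\<close>
  define u where "u j = fin_seq n a j *\<^sub>R v j" for j
  show thesis
  proof (rule that[of \<phi> u n], unfold r_def[symmetric])
    have "p_summable r (\<lambda>j. blinfun_apply \<Phi> (fin_seq n \<psi> j))" for \<Phi> :: "('x \<Rightarrow>\<^sub>L real) \<Rightarrow>\<^sub>L real"
      by (simp add: fin_seq_apply)
    then show "\<phi> \<in> lpw r" by (simp add: lpw_def \<phi>_def blinfun.scaleR_right divide_inverse mult.commute p_summable_scale)
    show "\<phi> j \<in> dual_cone" for j
      unfolding \<phi>_def using A' \<psi> by (intro dual_cone_scale fin_seq_dual_cone) auto
    have "lpw_norm r \<phi> \<le> \<bar>1 / A'\<bar> * A"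
      unfolding \<phi>_def A_def by (rule lpw_norm_scale_le[OF r fin_seq_in_lpw])
    also have "\<dots> \<le> 1" using A' by simp
    finally show "lpw_norm r \<phi> \<le> 1" .
    have le: "\<bar>norm (u j)\<bar> \<le> \<bar>fin_seq n a j\<bar>" for j
      using v[of j] by (simp add: u_def fin_seq_def mult_left_le)
    then show "u \<in> lp p" unfolding lp_def by (intro CollectI p_summable_mono[OF p_summable_fin_seq])
    show "lp_norm p u \<le> 1"
      unfolding lp_norm_def using p_norm_mono[OF p_summable_fin_seq le] a(1) by (rule order_trans)
    have "(\<Sum>j<n. blinfun_apply (\<phi> j) (blinfun_apply S (u j))) = Y / A'"
      unfolding a(2)[symmetric] sum_divide_distrib
      by (intro sum.cong) (simp_all add: \<phi>_def u_def fin_seq_def scaleR_blinfun.rep_eq blinfun.scaleR_right)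
    moreover have "C < Y / A'" using A' by (simp add: field_simps)
    ultimately show "C < (\<Sum>j<n. blinfun_apply (\<phi> j) (blinfun_apply S (u j)))" by simp
  qed
qed

text \<open>If every constant failed, one damped representation would contain blocks with
  arbitrarily large traces. Multipliers that single out a block contradict the uniform bound of
  \<open>bounded_trace_of_U_star\<close>.\<close>

lemma majorizing_of_U_star:
  fixes S :: "'e::banach \<Rightarrow>\<^sub>L 'x::banach_lattice"
  assumes p: "1 \<le> p" and AP: "approximation_property TYPE('e)" and S: "S \<in> U_star p"
  shows "\<exists>C>0. majorizing_const (conj_exp p) S C"
proof (rule ccontr)
  assume "\<not> ?thesis"
  \<comment> \<open>Functionals and vectors of block \<open>k\<close> are both damped by
    \<open>(1 / 2) ^ k\<close>, which costs a factor \<open>(1 / 4) ^ k\<close> in the trace;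
    starting from \<open>8 ^ k\<close> leaves more than \<open>2 ^ k\<close>.\<close>
  then have not: "\<not> majorizing_const (conj_exp p) S (8 ^ k)" for k :: nat by auto
  define r where "r = conj_exp p"
  have r: "1 \<le> r" unfolding r_def using p by (rule conj_exp_ge_1)
  have "\<forall>k :: nat. \<exists>z. case z of (n, \<phi>, u) \<Rightarrow> \<phi> \<in> lpw r \<and> (\<forall>j. \<phi> j \<in> dual_cone) \<and> lpw_norm r \<phi> \<le> 1 \<and>
      u \<in> lp p \<and> lp_norm p u \<le> 1 \<and> 8 ^ k < (\<Sum>j<n::nat. blinfun_apply (\<phi> j) (blinfun_apply S (u j)))"
  proof
    fix k :: nat
    obtain n \<phi> u where "\<phi> \<in> lpw r" "\<And>j. \<phi> j \<in> dual_cone" "lpw_norm r \<phi> \<le> 1"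
      "u \<in> lp p" "lp_norm p u \<le> 1" "8 ^ k < (\<Sum>j<n::nat. blinfun_apply (\<phi> j) (blinfun_apply S (u j)))"
      by (rule large_trace_of_not_majorizing[OF p not[of k], folded r_def], rule that)
    then show "\<exists>z. case z of (n, \<phi>, u) \<Rightarrow> \<phi> \<in> lpw r \<and> (\<forall>j. \<phi> j \<in> dual_cone) \<and> lpw_norm r \<phi> \<le> 1 \<and>
      u \<in> lp p \<and> lp_norm p u \<le> 1 \<and> 8 ^ k < (\<Sum>j<n::nat. blinfun_apply (\<phi> j) (blinfun_apply S (u j)))"
      by (intro exI[of _ "(n, \<phi>, u)"]) simp
  qed
  from choice[OF this] obtain z where z: "\<forall>k. case z k of (n, \<phi>, u) \<Rightarrow>
      \<phi> \<in> lpw r \<and> (\<forall>j. \<phi> j \<in> dual_cone) \<and> lpw_norm r \<phi> \<le> 1 \<and>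
      u \<in> lp p \<and> lp_norm p u \<le> 1 \<and> 8 ^ k < (\<Sum>j<n::nat. blinfun_apply (\<phi> j) (blinfun_apply S (u j)))" ..
  define n where "n k = fst (z k)" for k
  define \<phi> where "\<phi> k = fst (snd (z k))" for k
  define u where "u k = snd (snd (z k))" for k
  have \<phi>: "\<phi> k \<in> lpw r" "\<phi> k j \<in> dual_cone" "lpw_norm r (\<phi> k) \<le> 1" for k j
    using z[rule_format, of k] by (auto simp: \<phi>_def split: prod.splits)
  have u: "u k \<in> lp p" "lp_norm p (u k) \<le> 1" for k
    using z[rule_format, of k] by (auto simp: u_def split: prod.splits)
  have big: "8 ^ k < (\<Sum>j<n k. blinfun_apply (\<phi> k j) (blinfun_apply S (u k j)))" for k
    using z[rule_format, of k] by (auto simp: n_def \<phi>_def u_def split: prod.splits)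
  define \<psi> where "\<psi> i = (case prod_decode i of (k, j) \<Rightarrow> (1 / 2) ^ k *\<^sub>R \<phi> k j)" for i
  define w where "w i = (case prod_decode i of (k, j) \<Rightarrow> (1 / 2) ^ k *\<^sub>R u k j)" for i
  have \<psi>: "\<psi> \<in> lpw r"
    unfolding lpw_def
  proof (intro CollectI allI)
    fix \<Phi> :: "('x \<Rightarrow>\<^sub>L real) \<Rightarrow>\<^sub>L real"
    have "p_norm r (\<lambda>j. blinfun_apply \<Phi> (\<phi> k j)) \<le> norm \<Phi>" for k
      using lpw_norm_upper[OF r \<phi>(1)[of k], of \<Phi>] mult_left_mono[OF \<phi>(3)[of k], of "norm \<Phi>"] by simp
    then have "p_summable r (\<lambda>i. case prod_decode i of (k, j) \<Rightarrow> (1 / 2) ^ k * blinfun_apply \<Phi> (\<phi> k j))"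
      using \<phi>(1) by (intro p_summable_prod_decode[OF r]) (auto simp: lpw_def)
    moreover have "(case prod_decode i of (k, j) \<Rightarrow> (1 / 2) ^ k * blinfun_apply \<Phi> (\<phi> k j)) = blinfun_apply \<Phi> (\<psi> i)" for i
      by (simp add: \<psi>_def blinfun.scaleR_right split: prod.split)
    ultimately show "p_summable r (\<lambda>i. blinfun_apply \<Phi> (\<psi> i))" by simp
  qed
  have \<psi>_pos: "\<psi> i \<in> dual_cone" for i
    using \<phi>(2) by (simp add: \<psi>_def dual_cone_scale split: prod.split)
  have w: "w \<in> lp p"
  proof -
    have "p_summable p (\<lambda>i. case prod_decode i of (k, j) \<Rightarrow> (1 / 2) ^ k * norm (u k j))"
      using u by (intro p_summable_prod_decode[OF p, where D = 1]) (auto simp: lp_def lp_norm_def)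
    moreover have "(case prod_decode i of (k, j) \<Rightarrow> (1 / 2) ^ k * norm (u k j)) = norm (w i)" for i
      by (simp add: w_def split: prod.split)
    ultimately show ?thesis by (simp add: lp_def)
  qed
  from bounded_trace_of_U_star[OF p AP S \<psi>[unfolded r_def] \<psi>_pos w]
  obtain M where M: "\<forall>N b. (\<forall>i. \<bar>b i\<bar> \<le> 1) \<longrightarrow>
      \<bar>\<Sum>i<N. b i * blinfun_apply (\<psi> i) (blinfun_apply S (w i))\<bar> \<le> M" ..
  obtain k where k: "M < 2 ^ k" using real_arch_pow[of 2 M] by auto
  \<comment> \<open>\<open>F\<close> is the set of positions of block \<open>k\<close> in the merged
    sequence; its indicator is the multiplier that isolates the block.\<close>
  define F where "F = (\<lambda>j. prod_encode (k, j)) ` {..<n k}"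
  have inj: "inj_on (\<lambda>j. prod_encode (k, j)) {..<n k}" by (auto simp: inj_on_def)
  obtain N where N: "F \<subseteq> {..<N}"
    using finite_nat_bounded[of F] unfolding F_def by blast
  have "(\<Sum>i<N. indicator F i * blinfun_apply (\<psi> i) (blinfun_apply S (w i)))
      = (\<Sum>i\<in>F. blinfun_apply (\<psi> i) (blinfun_apply S (w i)))"
    using N by (intro sum.mono_neutral_cong_right) (auto simp: indicator_def)
  also have "\<dots> = (\<Sum>j<n k. (1 / 4) ^ k * blinfun_apply (\<phi> k j) (blinfun_apply S (u k j)))"
    unfolding F_def sum.reindex[OF inj]
    by (simp add: \<psi>_def w_def scaleR_blinfun.rep_eq blinfun.scaleR_right flip: power_mult_distrib mult.assoc)
  also have "\<dots> > (1 / 4) ^ k * 8 ^ k"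
    using big[of k] by (simp flip: sum_distrib_left)
  also have "(1 / 4) ^ k * 8 ^ k = (2 :: real) ^ k"
    by (simp flip: power_mult_distrib)
  finally show False using M[rule_format, of "indicator F" N] k by (auto simp: indicator_def)
qed

section \<open>Comparison of the majorizing norm with \<open>zeta\<close>\<close>

lemma zeta_upper:
  fixes S :: "'e::banach \<Rightarrow>\<^sub>L 'x::banach_lattice" and T :: "'x \<Rightarrow>\<^sub>L 'e"
  assumes p: "1 \<le> p" and S: "S \<in> U_star p"
    and bdd: "bdd_above ((\<lambda>T. nuclear_norm (T o\<^sub>L S)) ` {T :: 'x \<Rightarrow>\<^sub>L 'e. T \<in> pos_nuclear p \<and> pos_nuclear_norm p T \<le> 1})"
    and rep: "pos_nuclear_rep p T \<phi> u"
  shows "nuclear_norm (T o\<^sub>L S) \<le> zeta p S * (lpw_norm (conj_exp p) \<phi> * lp_norm p u)"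
proof -
  define A where "A = lpw_norm (conj_exp p) \<phi> * lp_norm p u"
  have \<phi>: "\<phi> \<in> lpw (conj_exp p)" and u: "u \<in> lp p" using rep by (auto simp: pos_nuclear_rep_def)
  have A: "0 \<le> A"
    unfolding A_def by (intro mult_nonneg_nonneg lpw_norm_nonneg lp_norm_nonneg conj_exp_ge_1 p \<phi> u)
  have step: "0 \<le> zeta p S \<and> nuclear_norm (T o\<^sub>L S) \<le> (A + e) * zeta p S" if "0 < e" for e
  proof -
    \<comment> \<open>This factor brings the representation, and with it \<open>T\<close>, into the
      unit ball; \<open>e\<close> covers the case \<open>A = 0\<close> and is removed at the
      end.\<close>
    define c where "c = 1 / (A + e)"
    have c: "0 < c" "(A + e) * c = 1" "c * A \<le> 1" using A that by (simp_all add: c_def field_simps)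
    have rep': "pos_nuclear_rep p (c *\<^sub>R T) \<phi> (\<lambda>j. c *\<^sub>R u j)"
      using rep lp_mult[OF u, of "\<lambda>_. c" c] c(1) by (simp add: pos_nuclear_rep_def rank_one_series_scale)
    then have T': "c *\<^sub>R T \<in> pos_nuclear p" by (auto simp: pos_nuclear_def)
    have "pos_nuclear_norm p (c *\<^sub>R T) \<le> c * A"
      using pos_nuclear_norm_le[OF p rep'] c(1) by (simp add: lp_norm_scale[OF p u] A_def mult.left_commute)
    with c T' have mem: "c *\<^sub>R T \<in> {T. T \<in> pos_nuclear p \<and> pos_nuclear_norm p T \<le> 1}" by auto
    have nuc: "(c *\<^sub>R T) o\<^sub>L S \<in> nuclear" using S T' by (simp add: U_star_def)
    have le: "nuclear_norm ((c *\<^sub>R T) o\<^sub>L S) \<le> zeta p S"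
      unfolding zeta_def by (rule cSUP_upper[OF mem bdd])
    have "T o\<^sub>L S = (A + e) *\<^sub>R ((c *\<^sub>R T) o\<^sub>L S)"
      by (rule blinfun_eqI) (simp add: scaleR_blinfun.rep_eq c(2))
    then have "nuclear_norm (T o\<^sub>L S) \<le> \<bar>A + e\<bar> * nuclear_norm ((c *\<^sub>R T) o\<^sub>L S)"
      using nuclear_norm_scale[OF nuc, of "A + e"] by simp
    also have "\<dots> \<le> (A + e) * zeta p S" using A that le by (simp add: mult_left_mono)
    finally show ?thesis using le nuclear_norm_nonneg[OF nuc] by linarith
  qed
  have "nuclear_norm (T o\<^sub>L S) \<le> zeta p S * A + e" if "0 < e" for e
  proof -
    have z: "0 \<le> zeta p S" using step[of 1] by simp
    then have "0 < e / (zeta p S + 1)" using that by simp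
    from step[OF this] have "nuclear_norm (T o\<^sub>L S) \<le> A * zeta p S + e / (zeta p S + 1) * zeta p S"
      by (simp add: distrib_right)
    also have "e / (zeta p S + 1) * zeta p S \<le> e" using z that by (simp add: field_simps)
    finally show ?thesis by (simp add: mult.commute)
  qed
  then have "nuclear_norm (T o\<^sub>L S) \<le> zeta p S * A" by (rule field_le_epsilon)
  then show ?thesis by (simp add: A_def)
qed

text \<open>The supremum in \<open>zeta\<close> is handled by rules for nonempty sets.\<close>

lemma pos_nuclear_unit_ball_nonempty:
  assumes "1 \<le> p"
  shows "(0 :: 'x::banach_lattice \<Rightarrow>\<^sub>L 'e::banach) \<in> {T. T \<in> pos_nuclear p \<and> pos_nuclear_norm p T \<le> 1}"
proof -
  have "pos_nuclear_rep p (0 :: 'x \<Rightarrow>\<^sub>L 'e) (\<lambda>_. 0) (\<lambda>_. 0)"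
    by (simp add: pos_nuclear_rep_def lpw_def lp_def dual_cone_def rank_one_series_def)
  moreover from pos_nuclear_norm_le[OF assms this] have "pos_nuclear_norm p (0 :: 'x \<Rightarrow>\<^sub>L 'e) \<le> 0"
    by (simp add: lp_norm_def)
  ultimately show ?thesis by (auto simp: pos_nuclear_def)
qed

lemma zeta_nonneg:
  fixes S :: "'e::banach \<Rightarrow>\<^sub>L 'x::banach_lattice"
  assumes p: "1 \<le> p" and S: "S \<in> U_star p"
    and bdd: "bdd_above ((\<lambda>T. nuclear_norm (T o\<^sub>L S)) ` {T :: 'x \<Rightarrow>\<^sub>L 'e. T \<in> pos_nuclear p \<and> pos_nuclear_norm p T \<le> 1})"
  shows "0 \<le> zeta p S"
proof -
  have "0 \<le> nuclear_norm ((0 :: 'x \<Rightarrow>\<^sub>L 'e) o\<^sub>L S)"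
    using S pos_nuclear_unit_ball_nonempty[OF p, where 'x = 'x and 'e = 'e]
    by (intro nuclear_norm_nonneg) (auto simp: U_star_def)
  also have "\<dots> \<le> zeta p S"
    unfolding zeta_def by (rule cSUP_upper[OF pos_nuclear_unit_ball_nonempty[OF p] bdd])
  finally show ?thesis .
qed

lemma nuclear_norm_le_of_unit_ball:
  fixes S :: "'e::banach \<Rightarrow>\<^sub>L 'x::banach_lattice" and T :: "'x \<Rightarrow>\<^sub>L 'e"
  assumes p: "1 \<le> p" and maj: "majorizing_const (conj_exp p) S C" and C: "0 < C"
    and T: "T \<in> {T. T \<in> pos_nuclear p \<and> pos_nuclear_norm p T \<le> 1}"
  shows "nuclear_norm (T o\<^sub>L S) \<le> C"
proof -
  have "nuclear_norm (T o\<^sub>L S) \<le> C * pos_nuclear_norm p T"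
    using T by (intro nuclear_norm_le_majorizing p maj C) simp
  also have "\<dots> \<le> C" using T C by simp
  finally show ?thesis .
qed

text \<open>The trace argument again, now with the exact constant: a norming sequence makes the left
  side the trace of \<open>T o\<^sub>L S\<close>, and \<open>zeta_upper\<close> bounds its nuclear
  norm. All \<open>C\<close> from \<open>zeta p S\<close> upwards are covered because admissible
  constants must be positive while \<open>zeta p S\<close> may be 0.\<close>

lemma majorizing_const_zeta:
  fixes S :: "'e::banach \<Rightarrow>\<^sub>L 'x::banach_lattice"
  assumes p: "1 \<le> p" and AP: "approximation_property TYPE('e)" and S: "S \<in> U_star p"
    and bdd: "bdd_above ((\<lambda>T. nuclear_norm (T o\<^sub>L S)) ` {T :: 'x \<Rightarrow>\<^sub>L 'e. T \<in> pos_nuclear p \<and> pos_nuclear_norm p T \<le> 1})"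
    and C: "zeta p S \<le> C"
  shows "majorizing_const (conj_exp p) S C"
  unfolding majorizing_const_def
proof (intro allI impI)
  fix n and v :: "nat \<Rightarrow> 'e" and \<psi> :: "nat \<Rightarrow> 'x \<Rightarrow>\<^sub>L real"
  assume v: "\<forall>j<n. norm (v j) \<le> 1" and \<psi>: "\<forall>j<n. \<psi> j \<in> dual_cone"
  define Y where "Y = p_norm (conj_exp p) (fin_seq n (\<lambda>j. blinfun_apply (\<psi> j) (blinfun_apply S (v j))))"
  define A where "A = lpw_norm (conj_exp p) (fin_seq n \<psi>)"
  have A: "0 \<le> A" unfolding A_def by (rule lpw_norm_nonneg[OF conj_exp_ge_1[OF p] fin_seq_in_lpw])
  obtain a where a: "p_norm p (fin_seq n a) \<le> 1"
    "(\<Sum>j<n. a j * blinfun_apply (\<psi> j) (blinfun_apply S (v j))) = Y"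
    using Hoelder_attained[OF p, of n "\<lambda>j. blinfun_apply (\<psi> j) (blinfun_apply S (v j))"]
    unfolding Y_def by blast
  define u where "u j = fin_seq n a j *\<^sub>R v j" for j
  have le: "\<bar>norm (u j)\<bar> \<le> \<bar>fin_seq n a j\<bar>" for j
    using v by (simp add: u_def fin_seq_def mult_left_le)
  then have u: "u \<in> lp p" unfolding lp_def by (intro CollectI p_summable_mono[OF p_summable_fin_seq])
  have u1: "lp_norm p u \<le> 1"
    unfolding lp_norm_def using p_norm_mono[OF p_summable_fin_seq le] a(1) by (rule order_trans)
  obtain T :: "'x \<Rightarrow>\<^sub>L 'e" where T: "rank_one_series (fin_seq n \<psi>) u T"
    using rank_one_series_exists[OF p fin_seq_in_lpw u] by blast
  have rep: "pos_nuclear_rep p T (fin_seq n \<psi>) u"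
    using u T \<psi> by (simp add: pos_nuclear_rep_def fin_seq_in_lpw fin_seq_dual_cone)
  have "T o\<^sub>L S \<in> nuclear" using S rep by (auto simp: U_star_def pos_nuclear_def)
  moreover have "blinfun_apply (T o\<^sub>L S) y = (\<Sum>j<n. blinfun_apply (\<psi> j o\<^sub>L S) y *\<^sub>R u j)" for y
  proof -
    have "(\<lambda>j. blinfun_apply (fin_seq n \<psi> j) (blinfun_apply S y) *\<^sub>R u j) sums
        (\<Sum>j<n. blinfun_apply (fin_seq n \<psi> j) (blinfun_apply S y) *\<^sub>R u j)"
      by (rule sums_finite) (auto simp: fin_seq_def)
    moreover have "(\<lambda>j. blinfun_apply (fin_seq n \<psi> j) (blinfun_apply S y) *\<^sub>R u j) sums blinfun_apply T (blinfun_apply S y)"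
      using T by (simp add: rank_one_series_def)
    ultimately have "blinfun_apply T (blinfun_apply S y) = (\<Sum>j<n. blinfun_apply (fin_seq n \<psi> j) (blinfun_apply S y) *\<^sub>R u j)"
      by (rule sums_unique2[symmetric])
    then show ?thesis by (simp add: fin_seq_def)
  qed
  ultimately have "\<bar>\<Sum>j<n. blinfun_apply (\<psi> j o\<^sub>L S) (u j)\<bar> \<le> nuclear_norm (T o\<^sub>L S)"
    by (rule trace_le_nuclear_norm[OF AP])
  moreover have "(\<Sum>j<n. blinfun_apply (\<psi> j o\<^sub>L S) (u j)) = Y"
    unfolding a(2)[symmetric] by (intro sum.cong) (simp_all add: u_def fin_seq_def blinfun.scaleR_right)
  ultimately have "Y \<le> nuclear_norm (T o\<^sub>L S)" by linarith
  also have "\<dots> \<le> zeta p S * (A * lp_norm p u)"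
    unfolding A_def by (rule zeta_upper[OF p S bdd rep])
  also have "\<dots> \<le> C * (A * lp_norm p u)"
    using A lp_norm_nonneg[OF u] C by (intro mult_right_mono) auto
  also have "\<dots> \<le> C * A"
  proof -
    have "0 \<le> C" using zeta_nonneg[OF p S bdd] C by simp
    moreover have "A * lp_norm p u \<le> A" using A u1 by (simp add: mult_left_le)
    ultimately show ?thesis by (rule mult_left_mono[rotated])
  qed
  finally show "p_norm (conj_exp p) (fin_seq n (\<lambda>j. blinfun_apply (\<psi> j) (blinfun_apply S (v j))))
      \<le> C * lpw_norm (conj_exp p) (fin_seq n \<psi>)"
    by (simp add: Y_def A_def)
qed

section \<open>Equality of the spaces and of their norms\<close>

theorem theorem2p16:
  fixes p :: ennreal
  assumes "1 \<le> p"
    and "approximation_property TYPE('e::banach)"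
  shows "(pos_majorizing (conj_exp p) :: ('e \<Rightarrow>\<^sub>L 'x::banach_lattice) set) = U_star p
       \<and> (\<forall>S \<in> (U_star p :: ('e \<Rightarrow>\<^sub>L 'x) set). pos_majorizing_norm (conj_exp p) S = zeta p S)"
proof (intro conjI ballI set_eqI)
  note p = assms(1) and AP = assms(2)
  fix S :: "'e \<Rightarrow>\<^sub>L 'x"
  show "S \<in> pos_majorizing (conj_exp p) \<longleftrightarrow> S \<in> U_star p"
  proof
    assume "S \<in> pos_majorizing (conj_exp p)"
    then obtain C where "majorizing_const (conj_exp p) S C" "0 < C" by (auto simp: pos_majorizing_def)
    then show "S \<in> U_star p"
      unfolding U_star_def nuclear_def pos_nuclear_def using majorizing_nuclear_rep(1)[OF p] less_imp_le by blast
  qed (use majorizing_of_U_star[OF p AP] in \<open>auto simp: pos_majorizing_def\<close>)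
next
  note p = assms(1) and AP = assms(2)
  fix S :: "'e \<Rightarrow>\<^sub>L 'x" assume S: "S \<in> U_star p"
  \<comment> \<open>A majorizing constant, known from the equality of the spaces, bounds the
    supremum in \<open>zeta\<close>; the estimates involving \<open>zeta\<close> presuppose
    this.\<close>
  obtain C0 where C0: "0 < C0" "majorizing_const (conj_exp p) S C0"
    using majorizing_of_U_star[OF p AP S] by blast
  have bdd: "bdd_above ((\<lambda>T. nuclear_norm (T o\<^sub>L S)) ` {T :: 'x \<Rightarrow>\<^sub>L 'e. T \<in> pos_nuclear p \<and> pos_nuclear_norm p T \<le> 1})"
    by (rule bdd_aboveI2[of _ _ C0]) (rule nuclear_norm_le_of_unit_ball[OF p C0(2,1)])
  have z: "0 \<le> zeta p S" by (rule zeta_nonneg[OF p S bdd])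
  show "pos_majorizing_norm (conj_exp p) S = zeta p S"
  proof (rule antisym)
    show "pos_majorizing_norm (conj_exp p) S \<le> zeta p S"
    \<comment> \<open>Adding \<open>e\<close> produces a positive constant even when
      \<open>zeta p S\<close> is 0.\<close>
    proof (rule field_le_epsilon)
      fix e :: real assume "0 < e"
      have "majorizing_const (conj_exp p) S (zeta p S + e)"
        by (rule majorizing_const_zeta[OF p AP S bdd]) (use \<open>0 < e\<close> in simp)
      then show "pos_majorizing_norm (conj_exp p) S \<le> zeta p S + e"
        unfolding pos_majorizing_norm_def using z \<open>0 < e\<close>
        by (intro cInf_lower bdd_belowI[of _ 0]) auto
    qed
    show "zeta p S \<le> pos_majorizing_norm (conj_exp p) S"
      unfolding pos_majorizing_norm_def
    proof (rule cInf_greatest)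
      fix C assume "C \<in> {C. 0 < C \<and> majorizing_const (conj_exp p) S C}"
      then show "zeta p S \<le> C"
        unfolding zeta_def using pos_nuclear_unit_ball_nonempty[OF p]
        by (intro cSUP_least nuclear_norm_le_of_unit_ball[OF p]) auto
    qed (use C0 in auto)
  qed
qed

end
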